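(* Let $n\geq 0$, let $a=(a_0,\dots,a_n)$ be non-negative integers, let $v=(v_0,\dots,v_n)$ be a sequence of non-negative integers such that $v_0=\max\{v_0,\dots,v_n\}$ and $v_0$ has multiplicity one in $v$, and let $m\in\{1,2,\dots,n+1\}$. Then \[ D_{v,v^+}(a,m)=q^{\sum_{i=1}^{m-1}a_i-v_0}\begin{bmatrix} v_0+|a|-1\\ a_0-1\end{bmatrix}_q D_{v^{(0)},(v^{(0)})^+}\big(a^{(0)},m-1\big). \]
   Context: For an integer $k\geq 0$, $(z)_k=(z;q)_k=(1-z)(1-zq)\cdots(1-zq^{k-1})$. For an integer $N$ and non-negative integer $j$, $\begin{bmatrix} N\\ j\end{bmatrix}_q=(q^{N-j+1};q)_j/(q;q)_j$; for $j<0$ it is taken to be $0$. For a sequence $u=(u_0,\dots,u_n)$: $|u|=\sum u_i$, $u^+$ is its weakly decreasing rearrangement, $u^{(0)}=(u_1,\dots,u_n)$. $h_r$ is the complete homogeneous symmetric function, $h_\lambda=\prod_i h_{\lambda_i}$. For non-negative integers $a=(a_0,\dots,a_n)$ and $m\in\{0,1,\dots,n+1\}$, $x_m^{(a)}$ is the list of variables consisting of $x_iq^{-1},x_i,\dots,x_iq^{a_i-2}$ for each $i<m$ and $x_i,x_iq,\dots,x_iq^{a_i-1}$ for each $i\geq m$ (so $a_i$ variables for each $i$). For $v\in\mathbb{Z}^{n+1}$ and a partition $\lambda$ with $|\lambda|=|v|$, \[ D_{v,\lambda}(a,m)=\mathrm{CT}_x\, x^{-v}h_\lambda\big(x_m^{(a)}\big)\prod_{0\leq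 i<j\leq n}(x_i/x_j;q)_{a_i}(qx_j/x_i;q)_{a_j}, \] with $x^{-v}=\prod_i x_i^{-v_i}$ and $\mathrm{CT}_x$ the constant term in all variables $x_0,\dots,x_n$. On the right-hand side, the sequences are re-indexed as $a^{(0)}=(a_1,\dots,a_n)$, $v^{(0)}=(v_1,\dots,v_n)$ in variables $x_1,\dots,x_n$, with $m-1$ playing the role of $m$ (so the first $m-1$ of these variables carry the shift $q^{-1}$).
   Formalization: The single case n=0, a=(0), v=(0) is excluded by requiring v_0>0 or a_0>0: there the left side is 1, while the q-binomial with lower entry −1 is 0 by convention, so the claim fails. *)

theory Defs
  imports Complex_Main "HOL-Library.Poly_Mapping"
begin

text \<open>
  Laurent polynomials over \<open>'k\<close> in the variables \<open>x\<^sub>0, x\<^sub>1, x\<^sub>2, \<dots>\<close>: finitely supported maps from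
  integer exponent vectors to coefficients, multiplied by convolution.
\<close>

type_synonym 'k laurent = "(nat \<Rightarrow>\<^sub>0 int) \<Rightarrow>\<^sub>0 'k"

definition const_L :: "'k::zero \<Rightarrow> 'k laurent"
  where "const_L c = Poly_Mapping.single 0 c"

definition var_L :: "nat \<Rightarrow> 'k::zero_neq_one laurent"
  where "var_L i = Poly_Mapping.single (Poly_Mapping.single i 1) 1"

text \<open>The Laurent monomial \<open>x\<^sub>i / x\<^sub>j\<close>.\<close>

definition ratio_L :: "nat \<Rightarrow> nat \<Rightarrow> 'k::zero_neq_one laurent"
  where "ratio_L i j =
    Poly_Mapping.single (Poly_Mapping.single i 1 - Poly_Mapping.single j 1) 1"

text \<open>The Laurent monomial \<open>x\<^sup>-\<^sup>v\<close>.\<close>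

definition monom_neg_L :: "int list \<Rightarrow> 'k::zero_neq_one laurent"
  where "monom_neg_L v =
    Poly_Mapping.single (\<Sum>i<length v. Poly_Mapping.single i (- (v ! i))) 1"

definition CT :: "'k::zero laurent \<Rightarrow> 'k"
  where "CT p = Poly_Mapping.lookup p 0"

definition qpoch :: "'a::comm_ring_1 \<Rightarrow> 'a \<Rightarrow> nat \<Rightarrow> 'a"
  where "qpoch z q k = (\<Prod>i<k. 1 - z * q ^ i)"

text \<open>The upper argument may be any integer.\<close>

definition qbinom :: "'k::field \<Rightarrow> int \<Rightarrow> int \<Rightarrow> 'k"
  where "qbinom q N j =
    (if j < 0 then 0 else qpoch (q powi (N - j + 1)) q (nat j) / qpoch q q (nat j))"

text \<open>
  \<open>h\<^sub>r(y\<^sub>0, \<dots>, y\<^sub>k\<^sub>-\<^sub>1)\<close> is the sum of \<open>y\<^sub>i\<^sub>1 \<cdots> y\<^sub>i\<^sub>r\<close> over \<open>0 \<le> i\<^sub>1 \<le> \<dots> \<le> i\<^sub>r < k\<close>.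
\<close>

definition complete_sym :: "nat \<Rightarrow> 'a::comm_ring_1 list \<Rightarrow> 'a"
  where "complete_sym r ys =
    (\<Sum>is | length is = r \<and> set is \<subseteq> {..<length ys} \<and> sorted is.
       \<Prod>i\<leftarrow>is. ys ! i)"

definition complete_sym_partition :: "nat list \<Rightarrow> 'a::comm_ring_1 list \<Rightarrow> 'a"
  where "complete_sym_partition lam ys = (\<Prod>r\<leftarrow>lam. complete_sym r ys)"

text \<open>
  The list \<open>x\<^sub>m\<^sup>(\<^sup>a\<^sup>)\<close>: for each \<open>i\<close> the \<open>a\<^sub>i\<close> elements \<open>x\<^sub>i q\<^sup>k\<close> with \<open>0 \<le> k < a\<^sub>i\<close>, all multiplied by
  \<open>q\<^sup>-\<^sup>1\<close> when \<open>i < m\<close>.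
\<close>

definition xvars :: "'k::field \<Rightarrow> nat list \<Rightarrow> nat \<Rightarrow> 'k laurent list"
  where "xvars q a m =
    concat (map (\<lambda>i. map (\<lambda>k. const_L (q powi (int k - (if i < m then 1 else 0))) * var_L i)
      [0..<a ! i]) [0..<length a])"

text \<open>
  \<open>D\<^sub>v\<^sub>,\<^sub>\<lambda>(a,m)\<close>. The number of variables is the length of \<open>a\<close>, and the variables are always numbered
  from \<open>0\<close>; in particular, for the tails of \<open>a\<close> and \<open>v\<close>, \<open>x\<^sub>i\<close> here stands for \<open>x\<^sub>i\<^sub>+\<^sub>1\<close>.
\<close>

definition D_coeff :: "'k::field \<Rightarrow> int list \<Rightarrow> nat list \<Rightarrow> nat list \<Rightarrow> nat \<Rightarrow> 'k"
  where "D_coeff q v lam a m =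
    CT (monom_neg_L v * complete_sym_partition lam (xvars q a m) *
        (\<Prod>(i, j) \<in> {(i, j). i < j \<and> j < length a}.
           qpoch (ratio_L i j) (const_L q) (a ! i) *
           qpoch (const_L q * ratio_L j i) (const_L q) (a ! j)))"

definition decr :: "nat list \<Rightarrow> nat list"
  where "decr v = rev (sort v)"

end

(*
  Lagrange interpolation in each variable writes the constant term of a Laurent polynomial of degree
  at most 0, whose exponents of x_i are at least -c_i, as a weighted sum of its values on a product
  of grids with c_i + 1 points; moreover only the part of degree 0 of the Laurent polynomial matters,
  so that it may be deformed by terms of lower degree.

  For D_{v,v^+}(a,m), let x_i run through powers q^(s_i + alpha_i), where s_i = 1 if i < m and
  s_i = 0 otherwise. The Dyson product vanishes unless the intervals [alpha_i, alpha_i + a_i), whose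
  union gives the exponents of the variables x_m^(a), are pairwise disjoint. Put
  N = v_0 + a_1 + ... + a_n and replace h_{v_0}(X) by h_{v_0}[X - Y] with
  Y = {q^k : k < N + a_0 - 1}. Since v_j < v_0 for j > 0, the grids can be chosen such that all
  intervals lie in Y unless alpha_0 = N. If they do, h_{v_0}[X - Y] = h_{v_0}[-Z] with v_0 - 1
  elements in Z, which is 0. At alpha_0 = N one has X - Y = u - Z with v_0 elements in Z, so that
  h_{v_0}[X - Y] is the product of the u - z. There the factors involving x_0 cancel against the
  difference between the grids for n + 1 and for n variables, and what remains is the grid sum for
  the shorter sequences times a constant.
*)
theory Submission
  imports Defs "HOL-Library.FuncSet" "HOL-Computational_Algebra.Polynomial"
    "HOL-Computational_Algebra.Formal_Power_Series"
begin

unbundle fps_syntax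

alias keys = Poly_Mapping.keys
alias lookup = Poly_Mapping.lookup

section \<open>Evaluation of Laurent polynomials\<close>

definition eval_monom :: "(nat \<Rightarrow> 'k::field) \<Rightarrow> (nat \<Rightarrow>\<^sub>0 int) \<Rightarrow> 'k"
  where "eval_monom x e = (\<Prod>i\<in>keys e. x i powi lookup e i)"

definition eval_L :: "(nat \<Rightarrow> 'k::field) \<Rightarrow> 'k laurent \<Rightarrow> 'k"
  where "eval_L x p = (\<Sum>e\<in>keys p. lookup p e * eval_monom x e)"

lemma eval_monom_superset:
  assumes "finite A" "keys e \<subseteq> A"
  shows "eval_monom x e = (\<Prod>i\<in>A. x i powi lookup e i)"
  unfolding eval_monom_def
  by (rule prod.mono_neutral_left) (use assms in \<open>auto simp: in_keys_iff\<close>)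

lemma eval_monom_0 [simp]: "eval_monom x 0 = 1"
  by (simp add: eval_monom_def)

lemma eval_monom_add:
  assumes "\<And>i. x i \<noteq> 0"
  shows "eval_monom x (e + f) = eval_monom x e * eval_monom x f"
proof -
  let ?A = "keys e \<union> keys f"
  have "keys (e + f) \<subseteq> ?A" by (rule keys_add)
  then show ?thesis
    using assms by (simp add: eval_monom_superset[of ?A] lookup_add power_int_add prod.distrib)
qed

lemma eval_monom_single [simp]: "eval_monom x (Poly_Mapping.single i k) = x i powi k"
  by (simp add: eval_monom_def)

lemma eval_L_superset:
  assumes "finite A" "keys p \<subseteq> A"
  shows "eval_L x p = (\<Sum>e\<in>A. lookup p e * eval_monom x e)"
  unfolding eval_L_def
  by (rule sum.mono_neutral_left) (use assms in \<open>auto simp: in_keys_iff\<close>)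

lemma eval_L_0 [simp]: "eval_L x 0 = 0"
  by (simp add: eval_L_def)

lemma eval_L_single [simp]: "eval_L x (Poly_Mapping.single e c) = c * eval_monom x e"
  by (simp add: eval_L_def)

lemma eval_L_1 [simp]: "eval_L x 1 = 1"
  by (simp flip: single_one)

lemma eval_L_const [simp]: "eval_L x (const_L c) = c"
  by (simp add: const_L_def)

lemma eval_L_var [simp]: "eval_L x (var_L i) = x i"
  by (simp add: var_L_def)

lemma eval_L_add: "eval_L x (p + q) = eval_L x p + eval_L x q"
proof -
  let ?A = "keys p \<union> keys q"
  have "keys (p + q) \<subseteq> ?A" by (rule keys_add)
  then show ?thesis
    by (simp add: eval_L_superset[of ?A] lookup_add sum.distrib algebra_simps)
qed

lemma eval_L_uminus: "eval_L x (- p) = - eval_L x p"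
  by (metis add_eq_0_iff eval_L_0 eval_L_add right_minus)

lemma eval_L_diff: "eval_L x (p - q) = eval_L x p - eval_L x q"
  by (metis diff_conv_add_uminus eval_L_add eval_L_uminus)

lemma eval_L_sum: "eval_L x (\<Sum>i\<in>A. f i) = (\<Sum>i\<in>A. eval_L x (f i))"
  by (induction A rule: infinite_finite_induct) (simp_all add: eval_L_add)

lemma poly_mapping_sum_singles: "(\<Sum>e\<in>keys p. Poly_Mapping.single e (lookup p e)) = p"
  by (rule poly_mapping_eqI) (auto simp: lookup_sum lookup_single when_def in_keys_iff)

lemma eval_L_mult:
  assumes "\<And>i. x i \<noteq> 0"
  shows "eval_L x (p * q) = eval_L x p * eval_L x q"
proof -
  have "p * q = (\<Sum>e\<in>keys p. \<Sum>f\<in>keys q. Poly_Mapping.single (e + f) (lookup p e * lookup q f))"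
    using arg_cong2[OF poly_mapping_sum_singles[of p] poly_mapping_sum_singles[of q], of "(*)"]
    by (simp add: sum_product mult_single)
  then have "eval_L x (p * q) = (\<Sum>e\<in>keys p. \<Sum>f\<in>keys q.
      (lookup p e * lookup q f) * (eval_monom x e * eval_monom x f))"
    by (simp add: eval_L_sum eval_monom_add assms)
  also have "\<dots> = eval_L x p * eval_L x q"
    by (simp add: eval_L_def sum_product mult_ac)
  finally show ?thesis .
qed

lemma eval_L_prod:
  assumes "\<And>i. x i \<noteq> 0"
  shows "eval_L x (\<Prod>i\<in>A. f i) = (\<Prod>i\<in>A. eval_L x (f i))"
  by (induction A rule: infinite_finite_induct) (simp_all add: eval_L_mult assms)

lemma eval_L_prod_list:
  assumes "\<And>i. x i \<noteq> 0"
  shows "eval_L x (prod_list ps) = prod_list (map (eval_L x) ps)"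
  by (induction ps) (simp_all add: eval_L_mult assms)

lemma eval_L_power:
  assumes "\<And>i. x i \<noteq> 0"
  shows "eval_L x (p ^ k) = eval_L x p ^ k"
  by (induction k) (simp_all add: eval_L_mult assms)

lemma eval_L_ratio:
  assumes "\<And>i. x i \<noteq> 0"
  shows "eval_L x (ratio_L i j) = x i / x j"
proof -
  have *: "Poly_Mapping.single i 1 - Poly_Mapping.single j 1
      = Poly_Mapping.single i 1 + Poly_Mapping.single j (- 1 :: int)"
    by (simp add: single_uminus)
  show ?thesis
    by (simp only: ratio_L_def eval_L_single * eval_monom_add[OF assms])
       (simp add: power_int_minus field_simps)
qed

lemma eval_L_monom_neg:
  assumes "\<And>i. x i \<noteq> 0"
  shows "eval_L x (monom_neg_L v) = (\<Prod>i<length v. x i powi (- (v ! i)))"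
proof -
  have "eval_monom x (\<Sum>i\<in>A. Poly_Mapping.single i (u i)) = (\<Prod>i\<in>A. x i powi u i)"
    if "finite A" for A u
    using that by induction (simp_all add: eval_monom_add assms)
  then show ?thesis by (simp add: monom_neg_L_def)
qed

lemma eval_L_qpoch:
  assumes "\<And>i. x i \<noteq> 0"
  shows "eval_L x (qpoch z w k) = qpoch (eval_L x z) (eval_L x w) k"
  by (simp add: qpoch_def eval_L_prod eval_L_diff eval_L_mult eval_L_power assms)

lemma eval_L_complete_sym:
  assumes "\<And>i. x i \<noteq> 0"
  shows "eval_L x (complete_sym r ys) = complete_sym r (map (eval_L x) ys)"
  unfolding complete_sym_def eval_L_sum
proof (rule sum.cong)
  fix js assume "js \<in> {js. length js = r \<and> set js \<subseteq> {..<length (map (eval_L x) ys)} \<and> sorted js}"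
  then have "set js \<subseteq> {..<length ys}" by simp
  then show "eval_L x (\<Prod>i\<leftarrow>js. ys ! i) = (\<Prod>i\<leftarrow>js. map (eval_L x) ys ! i)"
    by (induction js) (auto simp: eval_L_mult assms)
qed simp


section \<open>Supports of Laurent polynomials\<close>

text \<open>These are the two bounds that summation over a grid requires: one from below for each
  single exponent, one from above for the total degree. The lower bound is imposed on all indices,
  so for nonzero \<open>p\<close> it must be nonpositive from \<open>N\<close> on.\<close>

definition supp_in :: "nat \<Rightarrow> (nat \<Rightarrow> int) \<Rightarrow> int \<Rightarrow> 'k::zero laurent \<Rightarrow> bool"
  where "supp_in N b d p \<longleftrightarrow>
    (\<forall>e\<in>keys p. keys e \<subseteq> {..<N} \<and> (\<forall>i. b i \<le> lookup e i) \<and> (\<Sum>i<N. lookup e i) \<le> d)"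

lemma supp_in_0 [simp]: "supp_in N b d 0"
  by (simp add: supp_in_def)

lemma supp_in_mono:
  assumes "supp_in N b d p" "\<And>i. b' i \<le> b i" "d \<le> d'"
  shows "supp_in N b' d' p"
  using assms unfolding supp_in_def by (meson order_trans)

lemma supp_in_add: "supp_in N b d p \<Longrightarrow> supp_in N b d q \<Longrightarrow> supp_in N b d (p + q)"
  unfolding supp_in_def using keys_add[of p q] by blast

lemma supp_in_uminus:
  fixes p :: "'k::ab_group_add laurent"
  shows "supp_in N b d p \<Longrightarrow> supp_in N b d (- p)"
  unfolding supp_in_def by (simp add: in_keys_iff)

lemma supp_in_diff:
  fixes p :: "'k::ab_group_add laurent"
  shows "supp_in N b d p \<Longrightarrow> supp_in N b d q \<Longrightarrow> supp_in N b d (p - q)"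
  by (metis diff_conv_add_uminus supp_in_add supp_in_uminus)

lemma supp_in_sum: "(\<And>i. i \<in> A \<Longrightarrow> supp_in N b d (f i)) \<Longrightarrow> supp_in N b d (\<Sum>i\<in>A. f i)"
  by (induction A rule: infinite_finite_induct) (auto intro: supp_in_add)

lemma supp_in_mult:
  fixes p q :: "'k::comm_ring_1 laurent"
  assumes "supp_in N b d p" "supp_in N b' d' q"
  shows "supp_in N (\<lambda>i. b i + b' i) (d + d') (p * q)"
  unfolding supp_in_def
proof
  fix g assume "g \<in> keys (p * q)"
  then obtain e f where g: "g = e + f" and e: "e \<in> keys p" and f: "f \<in> keys q"
    using keys_mult[of p q] by blast
  have "keys g \<subseteq> {..<N}"
    using keys_add[of e f] e f assms unfolding supp_in_def g by blast
  then show "keys g \<subseteq> {..<N} \<and> (\<forall>i. b i + b' i \<le> lookup g i) \<and> (\<Sum>i<N. lookup g i) \<le> d + d'"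
    using e f assms unfolding supp_in_def g
    by (auto simp: lookup_add sum.distrib intro!: add_mono)
qed

lemma supp_in_single:
  assumes "keys e \<subseteq> {..<N}"
  shows "supp_in N (lookup e) (\<Sum>i<N. lookup e i) (Poly_Mapping.single e c)"
  using assms by (auto simp: supp_in_def in_keys_iff lookup_single when_def)

lemma supp_in_const: "supp_in N (\<lambda>i. 0) 0 (const_L c)"
  by (auto simp: supp_in_def const_L_def)

lemma supp_in_1: "supp_in N (\<lambda>i. 0) 0 (1 :: 'k::comm_ring_1 laurent)"
  using supp_in_const[of N "1::'k"] by (simp add: const_L_def)

lemma supp_in_prod_list:
  fixes f :: "'a \<Rightarrow> 'k::comm_ring_1 laurent"
  assumes "\<And>j. j \<in> set js \<Longrightarrow> supp_in N (b j) (d j) (f j)"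
  shows "supp_in N (\<lambda>i. \<Sum>j\<leftarrow>js. b j i) (\<Sum>j\<leftarrow>js. d j) (\<Prod>j\<leftarrow>js. f j)"
  using assms
proof (induction js)
  case (Cons j js)
  then show ?case
    using supp_in_mult[of N "b j" "d j" "f j" "\<lambda>i. \<Sum>j\<leftarrow>js. b j i"] by simp
qed (simp add: supp_in_1)

lemma supp_in_var: "i < N \<Longrightarrow> supp_in N (\<lambda>i. 0) 1 (var_L i :: 'k::comm_ring_1 laurent)"
  unfolding var_L_def
  by (rule supp_in_mono[OF supp_in_single]) (auto simp: lookup_single when_def)

lemma supp_in_complete_sym:
  fixes ys :: "'k::comm_ring_1 laurent list"
  assumes "\<And>y. y \<in> set ys \<Longrightarrow> supp_in N (\<lambda>i. 0) 1 y"
  shows "supp_in N (\<lambda>i. 0) (int r) (complete_sym r ys)"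
  unfolding complete_sym_def
proof (rule supp_in_sum)
  fix js assume "js \<in> {js. length js = r \<and> set js \<subseteq> {..<length ys} \<and> sorted js}"
  then have "length js = r" "\<And>j. j \<in> set js \<Longrightarrow> supp_in N (\<lambda>i. 0) 1 (ys ! j)"
    using assms nth_mem by (auto simp: subset_iff)
  then show "supp_in N (\<lambda>i. 0) (int r) (\<Prod>j\<leftarrow>js. ys ! j)"
    using supp_in_prod_list[of js N "\<lambda>_ _. 0" "\<lambda>_. 1" "(!) ys"]
    by (simp add: sum_list_triv)
qed

text \<open>\<open>q\<close> is an inhomogeneous deformation of \<open>p\<close>.\<close>

definition same_top :: "nat \<Rightarrow> (nat \<Rightarrow> int) \<Rightarrow> int \<Rightarrow> 'k::comm_ring_1 laurent \<Rightarrow> 'k laurent \<Rightarrow> bool"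
  where "same_top N b d p q \<longleftrightarrow> supp_in N b d p \<and> supp_in N b (d - 1) (q - p)"

lemma same_top_refl: "supp_in N b d p \<Longrightarrow> same_top N b d p p"
  by (simp add: same_top_def)

lemma same_top_supp_in: "same_top N b d p q \<Longrightarrow> supp_in N b d q"
  using supp_in_add[of N b d p "q - p"] supp_in_mono[of N b "d - 1" "q - p" b d]
  by (simp add: same_top_def)

lemma same_top_mult:
  assumes "same_top N b d p q" "same_top N b' d' p' q'"
  shows "same_top N (\<lambda>i. b i + b' i) (d + d') (p * p') (q * q')"
proof -
  have "supp_in N (\<lambda>i. b i + b' i) (d - 1 + d') ((q - p) * q')"
    using assms by (intro supp_in_mult) (auto simp: same_top_def intro: same_top_supp_in)
  moreover have "supp_in N (\<lambda>i. b i + b' i) (d + (d' - 1)) (p * (q' - p'))"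
    using assms by (intro supp_in_mult) (auto simp: same_top_def)
  moreover have "d - 1 + d' = d + d' - 1" "d + (d' - 1) = d + d' - 1" by auto
  ultimately have "supp_in N (\<lambda>i. b i + b' i) (d + d' - 1) ((q - p) * q' + p * (q' - p'))"
    by (metis supp_in_add)
  moreover have "(q - p) * q' + p * (q' - p') = q * q' - p * p'" by (simp add: algebra_simps)
  ultimately show ?thesis
    using assms supp_in_mult[of N b d p b' d' p'] by (simp add: same_top_def)
qed

lemma same_top_prod:
  assumes "finite A" "\<And>j. j \<in> A \<Longrightarrow> same_top N (b j) (d j) (f j) (g j)"
  shows "same_top N (\<lambda>i. \<Sum>j\<in>A. b j i) (\<Sum>j\<in>A. d j) (\<Prod>j\<in>A. f j) (\<Prod>j\<in>A. g j)"
  using assms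
proof (induction A)
  case (insert j A)
  then have "same_top N (\<lambda>i. b j i + (\<Sum>j\<in>A. b j i)) (d j + (\<Sum>j\<in>A. d j))
      (f j * (\<Prod>j\<in>A. f j)) (g j * (\<Prod>j\<in>A. g j))"
    by (intro same_top_mult) auto
  with insert show ?case by simp
qed (simp add: supp_in_1 same_top_refl)

text \<open>The constant monomial has degree 0, while all monomials of \<open>q - p\<close> have
  negative degree.\<close>

lemma same_top_CT:
  assumes "same_top N b 0 p q"
  shows "CT q = CT p"
proof -
  have "0 \<notin> keys (q - p)" using assms by (auto simp: same_top_def supp_in_def)
  then show ?thesis by (simp add: CT_def in_keys_iff lookup_minus)
qed


section \<open>Constant terms as sums over a grid\<close>

text \<open>The coefficient of \<open>X\<^sup>c\<close> in the Lagrange interpolation formula for \<open>X\<^sup>k\<close>.\<close>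

lemma sum_power_div_prod_diff:
  fixes f :: "'a \<Rightarrow> 'k::field"
  assumes "finite S" "card S = Suc c" "inj_on f S" "k \<le> c"
  shows "(\<Sum>s\<in>S. f s ^ k / (\<Prod>t\<in>S - {s}. f s - f t)) = (if k = c then 1 else 0)"
proof -
  define L where "L s = (\<Prod>t\<in>S - {s}. [:- f t, 1:])" for s
  \<comment> \<open>\<open>P\<close> is the interpolation polynomial of X^k minus X^k itself. It has
    degree at most \<open>c\<close> but vanishes at \<open>Suc c\<close> points; the claim is that
    its coefficient at \<open>c\<close> is 0.\<close>
  define P where "P = (\<Sum>s\<in>S. smult (f s ^ k / (\<Prod>t\<in>S - {s}. f s - f t)) (L s)) - monom 1 k"
  have deg_L: "degree (L s) = c" "coeff (L s) c = 1" if "s \<in> S" for s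
  proof -
    show *: "degree (L s) = c"
      using that assms degree_prod_eq_sum_degree[of "S - {s}" "\<lambda>t. [:- f t, 1:]"]
      by (simp add: L_def)
    have "lead_coeff (L s) = 1" unfolding L_def lead_coeff_prod by simp
    with * show "coeff (L s) c = 1" by simp
  qed
  have "poly P (f s) = 0" if s: "s \<in> S" for s
  proof -
    have other: "poly (L s') (f s) = 0" if "s' \<in> S" "s' \<noteq> s" for s'
      using that s assms(1) by (auto simp: L_def poly_prod)
    have "poly (L s) (f s) = (\<Prod>t\<in>S - {s}. f s - f t)" by (simp add: L_def poly_prod)
    moreover have "(\<Prod>t\<in>S - {s}. f s - f t) \<noteq> 0"
      using assms(1,3) s by (auto simp: inj_on_def)
    ultimately have "poly (smult (f s ^ k / (\<Prod>t\<in>S - {s}. f s - f t)) (L s)) (f s) = f s ^ k" by simp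
    moreover have "(\<Sum>s'\<in>S - {s}. poly (smult (f s' ^ k / (\<Prod>t\<in>S - {s'}. f s' - f t)) (L s')) (f s)) = 0"
      by (rule sum.neutral) (use other in auto)
    ultimately show ?thesis
      using assms(1) s by (simp add: P_def poly_sum poly_monom sum.remove)
  qed
  then have roots: "f ` S \<subseteq> {x. poly P x = 0}" by auto
  have "degree P \<le> c"
    unfolding P_def
    by (intro degree_diff_le degree_sum_le order_trans[OF degree_smult_le] order_trans[OF degree_monom_le])
       (use assms deg_L in auto)
  have "P = 0"
  proof (rule ccontr)
    assume "P \<noteq> 0"
    then have "card (f ` S) \<le> degree P"
      by (meson roots card_mono card_poly_roots_bound le_trans poly_roots_finite)
    with \<open>degree P \<le> c\<close> show False using assms by (simp add: card_image)
  qed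
  then have "0 = coeff P c" by simp
  also have "\<dots> = (\<Sum>s\<in>S. f s ^ k / (\<Prod>t\<in>S - {s}. f s - f t)) - (if k = c then 1 else 0)"
    using deg_L by (auto simp: P_def coeff_sum intro!: sum.cong)
  finally show ?thesis by simp
qed

text \<open>For a monomial the grid sum factors over the variables. A nonconstant monomial of total
  degree at most 0 has a negative exponent somewhere, and the factor of that variable is 0, however
  large the other exponents are. The weights do not involve \<open>t\<close>, because scaling a
  variable preserves the constant term.\<close>

lemma CT_grid_sum:
  fixes p :: "'k::field laurent" and f :: "nat \<Rightarrow> 'a \<Rightarrow> 'k"
  assumes supp: "supp_in N (\<lambda>i. - int (c i)) 0 p"
    and S: "\<And>i. i < N \<Longrightarrow> finite (S i) \<and> card (S i) = Suc (c i) \<and> inj_on (f i) (S i) \<and> 0 \<notin> f i ` S i"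
    and t: "\<And>i. t i \<noteq> 0"
  shows "CT p = (\<Sum>\<alpha>\<in>PiE {..<N} S. eval_L (\<lambda>i. if i < N then t i * f i (\<alpha> i) else 1) p *
    (\<Prod>i<N. f i (\<alpha> i) ^ c i / (\<Prod>\<beta>\<in>S i - {\<alpha> i}. f i (\<alpha> i) - f i \<beta>)))"
proof -
  define w where "w i s = f i s ^ c i / (\<Prod>\<beta>\<in>S i - {s}. f i s - f i \<beta>)" for i s
  \<comment> \<open>Variables from \<open>N\<close> on get the value 1: negative exponents permit
    multiplicative evaluation only at nonzero points.\<close>
  define x where "x \<alpha> = (\<lambda>i. if i < N then t i * f i (\<alpha> i) else 1)" for \<alpha>
  have one: "(\<Sum>s\<in>S i. (t i * f i s) powi m * w i s) = (if m = 0 then 1 else 0)"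
    if i: "i < N" and m: "- int (c i) \<le> m" "m \<le> 0" for i m
  proof -
    \<comment> \<open>The numerator \<open>f i s ^ c i\<close> of the weight turns the exponent
      \<open>m\<close> into the nonnegative \<open>k\<close>, and \<open>k = c i\<close> exactly if
      \<open>m = 0\<close>.\<close>
    define k where "k = nat (m + int (c i))"
    have "(t i * f i s) powi m * w i s = t i powi m * (f i s ^ k / (\<Prod>\<beta>\<in>S i - {s}. f i s - f i \<beta>))"
      if "s \<in> S i" for s
    proof -
      have "f i s \<noteq> 0" using S[OF i] that by force
      moreover have "f i s ^ k = f i s powi (m + int (c i))"
        using m by (simp add: k_def power_int_def)
      ultimately have "f i s ^ k = f i s powi m * f i s ^ c i"
        by (simp add: power_int_add)
      then show ?thesis by (simp add: w_def power_int_mult_distrib)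
    qed
    then have "(\<Sum>s\<in>S i. (t i * f i s) powi m * w i s) =
        t i powi m * (\<Sum>s\<in>S i. f i s ^ k / (\<Prod>\<beta>\<in>S i - {s}. f i s - f i \<beta>))"
      by (simp add: sum_distrib_left)
    also have "\<dots> = t i powi m * (if k = c i then 1 else 0)"
      using S[OF i] m by (subst sum_power_div_prod_diff[of _ "c i"]) (auto simp: k_def)
    finally show ?thesis using m by (auto simp: k_def)
  qed
  have zero: "(\<Sum>s\<in>S i. (t i * f i s) powi m * w i s) = 0"
    if i: "i < N" and m: "- int (c i) \<le> m" "m < 0" for i m
    using one[of i m] that by simp
  have monom: "(\<Sum>\<alpha>\<in>PiE {..<N} S. eval_monom (x \<alpha>) e * (\<Prod>i<N. w i (\<alpha> i))) = (if e = 0 then 1 else 0)"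
    if e: "e \<in> keys p" for e
  proof -
    have e': "keys e \<subseteq> {..<N}" "\<And>i. - int (c i) \<le> lookup e i" "(\<Sum>i<N. lookup e i) \<le> 0"
      using e supp by (auto simp: supp_in_def)
    have "(\<Sum>\<alpha>\<in>PiE {..<N} S. eval_monom (x \<alpha>) e * (\<Prod>i<N. w i (\<alpha> i))) =
        (\<Sum>\<alpha>\<in>PiE {..<N} S. \<Prod>i<N. (t i * f i (\<alpha> i)) powi lookup e i * w i (\<alpha> i))"
      using e'(1) by (simp add: eval_monom_superset[of "{..<N}"] x_def prod.distrib)
    also have "\<dots> = (\<Prod>i<N. \<Sum>s\<in>S i. (t i * f i s) powi lookup e i * w i s)"
      using S by (subst prod_sum_PiE) auto
    also have "\<dots> = (if e = 0 then 1 else 0)"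
    proof (cases "e = 0")
      case True
      then show ?thesis using one[of _ 0] by simp
    next
      case False
      have "\<exists>i<N. lookup e i < 0"
      proof (rule ccontr)
        assume "\<not> ?thesis"
        then have nn: "\<And>i. i < N \<Longrightarrow> 0 \<le> lookup e i" by force
        then have "(\<Sum>i<N. lookup e i) = 0"
          using e'(3) sum_nonneg[of "{..<N}" "lookup e"] by force
        with nn have "\<And>i. i < N \<Longrightarrow> lookup e i = 0"
          by (subst (asm) sum_nonneg_eq_0_iff) auto
        moreover have "\<And>i. \<not> i < N \<Longrightarrow> lookup e i = 0"
          using e'(1) by (auto simp: in_keys_iff)
        ultimately have "e = 0" by (intro poly_mapping_eqI) (metis lookup_zero)
        with False show False by simp
      qed
      then show ?thesis using False zero e'(2) by (auto intro!: prod_zero)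
    qed
    finally show ?thesis .
  qed
  have "(\<Sum>\<alpha>\<in>PiE {..<N} S. eval_L (x \<alpha>) p * (\<Prod>i<N. w i (\<alpha> i))) =
      (\<Sum>e\<in>keys p. lookup p e * (\<Sum>\<alpha>\<in>PiE {..<N} S. eval_monom (x \<alpha>) e * (\<Prod>i<N. w i (\<alpha> i))))"
    unfolding eval_L_def sum_distrib_right sum_distrib_left
    by (subst sum.swap) (simp add: mult_ac)
  also have "\<dots> = (\<Sum>e\<in>keys p. lookup p e * (if e = 0 then 1 else 0))"
    using monom by (intro sum.cong) auto
  also have "\<dots> = CT p"
    by (simp add: CT_def if_distrib[of "(*) _"] in_keys_iff cong: if_cong)
  finally show ?thesis by (simp add: x_def w_def)
qed


section \<open>Complete symmetric functions\<close>

definition complete_sym_fps :: "'a::comm_ring_1 list \<Rightarrow> 'a fps"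
  where "complete_sym_fps ys = Abs_fps (\<lambda>r. complete_sym r ys)"

lemma complete_sym_0 [simp]: "complete_sym 0 ys = 1"
proof -
  have "{js. length js = 0 \<and> set js \<subseteq> {..<length ys} \<and> sorted js} = {[]}" by auto
  then show ?thesis by (simp only: complete_sym_def) simp
qed

lemma complete_sym_Nil: "complete_sym (Suc r) [] = 0"
proof -
  have "{js. length js = Suc r \<and> set js \<subseteq> {..<length ([] :: 'a list)} \<and> sorted js} = {}" by auto
  then show ?thesis by (simp only: complete_sym_def) simp
qed

text \<open>A weakly increasing list of indices either avoids the new last index or ends with it. In
  the second case, removing this entry leaves an arbitrary weakly increasing list of length
  \<open>r\<close>.\<close>

lemma complete_sym_snoc:
  fixes y :: "'a::comm_ring_1"
  shows "complete_sym (Suc r) (ys @ [y]) = complete_sym (Suc r) ys + y * complete_sym r (ys @ [y])"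
proof -
  define n where "n = length ys"
  define J where "J r k = {js. length js = r \<and> set js \<subseteq> {..<k} \<and> sorted js}" for r k :: nat
  have fin: "finite (J r k)" for r k
    using finite_lists_length_eq[of "{..<k}" r] by (rule finite_subset[rotated]) (auto simp: J_def)
  have split: "J (Suc r) (Suc n) = J (Suc r) n \<union> (\<lambda>js. js @ [n]) ` J r (Suc n)"
  proof (intro equalityI subsetI)
    fix js assume js: "js \<in> J (Suc r) (Suc n)"
    then have "js \<noteq> []" by (auto simp: J_def)
    then obtain ks k where eq: "js = ks @ [k]" by (metis rev_exhaust)
    show "js \<in> J (Suc r) n \<union> (\<lambda>js. js @ [n]) ` J r (Suc n)"
    proof (cases "k = n")
      case True
      then show ?thesis using js by (auto simp: J_def eq sorted_append)
    next
      case False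
      then have "k < n" using js by (auto simp: J_def eq)
      then show ?thesis using js by (fastforce simp: J_def eq sorted_append)
    qed
  next
    fix js assume "js \<in> J (Suc r) n \<union> (\<lambda>js. js @ [n]) ` J r (Suc n)"
    then show "js \<in> J (Suc r) (Suc n)"
      by (auto simp: J_def sorted_append subset_iff less_Suc_eq_le intro: less_imp_le)
  qed
  have disj: "J (Suc r) n \<inter> (\<lambda>js. js @ [n]) ` J r (Suc n) = {}"
    by (auto simp: J_def)
  have "complete_sym (Suc r) (ys @ [y]) = (\<Sum>js\<in>J (Suc r) (Suc n). \<Prod>i\<leftarrow>js. (ys @ [y]) ! i)"
    by (simp add: complete_sym_def J_def n_def)
  also have "\<dots> = (\<Sum>js\<in>J (Suc r) n. \<Prod>i\<leftarrow>js. (ys @ [y]) ! i) +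
      (\<Sum>js\<in>J r (Suc n). \<Prod>i\<leftarrow>js @ [n]. (ys @ [y]) ! i)"
    unfolding split by (subst sum.union_disjoint) (use fin disj in \<open>auto simp: sum.reindex inj_on_def\<close>)
  also have "(\<Sum>js\<in>J (Suc r) n. \<Prod>i\<leftarrow>js. (ys @ [y]) ! i) = complete_sym (Suc r) ys"
    unfolding complete_sym_def J_def n_def
    by (intro sum.cong refl arg_cong[of _ _ prod_list] map_cong) (auto simp: nth_append)
  also have "(\<Sum>js\<in>J r (Suc n). \<Prod>i\<leftarrow>js @ [n]. (ys @ [y]) ! i) = y * complete_sym r (ys @ [y])"
    by (simp add: complete_sym_def J_def n_def sum_distrib_left mult_ac)
  finally show ?thesis .
qed

lemma fps_nth_linear_mult:
  fixes u :: "'a::comm_ring_1"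
  shows "((1 - fps_const u * fps_X) * F) $ n = F $ n - u * (if n = 0 then 0 else F $ (n - 1))"
  by (simp only: left_diff_distrib mult_1_left mult.assoc fps_sub_nth fps_mult_left_const_nth fps_X_mult_nth)

text \<open>By the recursion for a new last variable, multiplication by 1 - y T removes y from the
  generating function of the h_r. The form without inverses makes sense over any commutative
  ring.\<close>

lemma complete_sym_fps_mult:
  "complete_sym_fps ys * (\<Prod>y\<leftarrow>ys. 1 - fps_const y * fps_X) = 1"
proof (induction ys rule: rev_induct)
  case Nil
  have "complete_sym_fps ([] :: 'a list) = 1"
    by (rule fps_ext) (auto simp: complete_sym_fps_def complete_sym_Nil gr0_conv_Suc)
  then show ?case by simp
next
  case (snoc y ys)
  have "(1 - fps_const y * fps_X) * complete_sym_fps (ys @ [y]) = complete_sym_fps ys"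
  proof (rule fps_ext)
    fix r show "((1 - fps_const y * fps_X) * complete_sym_fps (ys @ [y])) $ r = complete_sym_fps ys $ r"
      by (cases r) (simp_all only: fps_nth_linear_mult, simp_all add: complete_sym_fps_def complete_sym_snoc)
  qed
  moreover have swap: "A * (P * L) = (L * A) * P" for A P L :: "'a fps"
    by (simp add: mult_ac)
  moreover have "complete_sym_fps (ys @ [y]) * (\<Prod>y\<leftarrow>ys @ [y]. 1 - fps_const y * fps_X) =
      ((1 - fps_const y * fps_X) * complete_sym_fps (ys @ [y])) * (\<Prod>y\<leftarrow>ys. 1 - fps_const y * fps_X)"
    by (simp only: map_append prod_list.append list.map prod_list.Cons prod_list.Nil mult_1_right)
       (rule swap)
  ultimately show ?case using snoc by simp
qed

text \<open>Division by \<open>1 - u T\<close> turns the coefficient of \<open>T\<^bsup>card Z\<^esup>\<close> into evaluation at \<open>T = 1 / u\<close>.\<close>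

lemma fps_nth_prod_div_linear:
  fixes f :: "'b \<Rightarrow> 'a::comm_ring_1"
  assumes "finite Z" "F * (1 - fps_const u * fps_X) = (\<Prod>z\<in>Z. 1 - fps_const (f z) * fps_X)"
  shows "F $ card Z = (\<Prod>z\<in>Z. u - f z)"
proof -
  define G where "G = Abs_fps (\<lambda>n. u ^ n)"
  have G: "(1 - fps_const u * fps_X) * G = 1"
  proof (rule fps_ext)
    fix n show "((1 - fps_const u * fps_X) * G) $ n = 1 $ n"
      by (cases n) (simp_all only: fps_nth_linear_mult, simp_all add: G_def)
  qed
  \<comment> \<open>From degree \<open>card Z\<close> on, the coefficients form a geometric sequence
    with ratio \<open>u\<close>. All these degrees are needed in the induction, since a new linear
    factor combines two consecutive coefficients.\<close>
  have "((\<Prod>z\<in>Z. 1 - fps_const (f z) * fps_X) * G) $ n = u ^ (n - card Z) * (\<Prod>z\<in>Z. u - f z)"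
    if "card Z \<le> n" for n
    using assms(1) that
  proof (induction Z arbitrary: n)
    case empty
    then show ?case by (simp add: G_def)
  next
    case (insert w Z)
    let ?P = "(\<Prod>z\<in>Z. 1 - fps_const (f z) * fps_X) * G"
    from insert obtain k where n: "n = Suc k" by (cases n) auto
    have "((\<Prod>z\<in>insert w Z. 1 - fps_const (f z) * fps_X) * G) $ n = ((1 - fps_const (f w) * fps_X) * ?P) $ n"
      by (simp only: prod.insert[OF insert(1,2)] mult.assoc)
    also have "\<dots> = ?P $ n - f w * ?P $ k" by (simp only: fps_nth_linear_mult) (simp add: n)
    also have "\<dots> = u ^ (n - card (insert w Z)) * (\<Prod>z\<in>insert w Z. u - f z)"
      using insert n by (simp add: Suc_diff_le algebra_simps)
    finally show ?case .
  qed
  moreover have "F = (\<Prod>z\<in>Z. 1 - fps_const (f z) * fps_X) * G"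
    by (metis G assms(2) mult.assoc mult.right_neutral)
  ultimately show ?thesis by simp
qed

lemma fps_nth_prod_linear_eq_0:
  fixes f :: "'b \<Rightarrow> 'a::comm_ring_1"
  assumes "finite Z" "card Z < n"
  shows "(\<Prod>z\<in>Z. 1 - fps_const (f z) * fps_X) $ n = 0"
  using assms
proof (induction Z arbitrary: n)
  case (insert w Z)
  let ?P = "\<Prod>z\<in>Z. 1 - fps_const (f z) * fps_X"
  from insert obtain k where n: "n = Suc k" by (cases n) auto
  have "(\<Prod>z\<in>insert w Z. 1 - fps_const (f z) * fps_X) = (1 - fps_const (f w) * fps_X) * ?P"
    by (simp only: prod.insert[OF insert(1,2)])
  then show ?case using insert n by (simp only: fps_nth_linear_mult) simp
qed simp


section \<open>The Dyson coefficients as grid sums\<close>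

text \<open>The deformation touches the last factor only, so that zeros from all other factors
  survive it. The empty symbol has no factor to deform.\<close>

definition qpoch_shift :: "'a::comm_ring_1 \<Rightarrow> 'a \<Rightarrow> nat \<Rightarrow> 'a \<Rightarrow> 'a"
  where "qpoch_shift z q k c = (if k = 0 then 1 else qpoch z q (k - 1) * (1 - z * q ^ (k - 1) - c))"

lemma qpoch_0 [simp]: "qpoch z q 0 = 1"
  by (simp add: qpoch_def)

lemma qpoch_Suc: "qpoch z q (Suc k) = qpoch z q k * (1 - z * q ^ k)"
  by (simp add: qpoch_def)

lemma qpoch_shift_0 [simp]: "qpoch_shift z q k 0 = qpoch z q k"
  by (cases k) (simp_all add: qpoch_shift_def qpoch_Suc)

definition index_pairs :: "nat \<Rightarrow> (nat \<times> nat) set"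
  where "index_pairs N = {(i, j). i < j \<and> j < N}"

lemma finite_index_pairs [simp]: "finite (index_pairs N)"
  by (rule finite_subset[of _ "{..<N} \<times> {..<N}"]) (auto simp: index_pairs_def)

text \<open>With \<open>f i = - a_i\<close> this bounds the exponent of x_l in the Dyson product
  from below: of the two symbols of a pair containing \<open>l\<close>, one has x_l in the
  denominator, and its length is the entry of \<open>a\<close> at the other index.\<close>

lemma sum_index_pairs_incident:
  fixes f :: "nat \<Rightarrow> int"
  assumes "l < N"
  shows "(\<Sum>(i, j)\<in>index_pairs N. (if l = j then f i else 0) + (if l = i then f j else 0)) =
    (\<Sum>i<N. f i) - f l"
proof -
  have "(\<Sum>(i, j)\<in>index_pairs N. if l = j then f i else 0) =
      (\<Sum>p\<in>{p \<in> index_pairs N. l = snd p}. f (fst p))"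
    by (subst sum.inter_filter) (auto simp: case_prod_beta intro!: sum.cong)
  also have "\<dots> = (\<Sum>i<l. f i)"
    by (rule sum.reindex_bij_witness[of _ "\<lambda>i. (i, l)" fst]) (use assms in \<open>auto simp: index_pairs_def\<close>)
  finally have 1: "(\<Sum>(i, j)\<in>index_pairs N. if l = j then f i else 0) = (\<Sum>i<l. f i)" .
  have "(\<Sum>(i, j)\<in>index_pairs N. if l = i then f j else 0) =
      (\<Sum>p\<in>{p \<in> index_pairs N. l = fst p}. f (snd p))"
    by (subst sum.inter_filter) (auto simp: case_prod_beta intro!: sum.cong)
  also have "\<dots> = (\<Sum>i\<in>{l<..<N}. f i)"
    by (rule sum.reindex_bij_witness[of _ "\<lambda>i. (l, i)" snd]) (use assms in \<open>auto simp: index_pairs_def\<close>)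
  finally have 2: "(\<Sum>(i, j)\<in>index_pairs N. if l = i then f j else 0) = (\<Sum>i\<in>{l<..<N}. f i)" .
  have "{..<N} = insert l ({..<l} \<union> {l<..<N})" using assms by auto
  then have "(\<Sum>i<N. f i) = f l + ((\<Sum>i<l. f i) + (\<Sum>i\<in>{l<..<N}. f i))"
    by (simp add: sum.union_disjoint disjoint_iff)
  then show ?thesis using 1 2 by (simp add: case_prod_beta sum.distrib)
qed

definition scaled_powers :: "'k::field \<Rightarrow> nat list \<Rightarrow> (nat \<Rightarrow> nat) \<Rightarrow> 'k list"
  where "scaled_powers q a \<alpha> =
    concat (map (\<lambda>i. map (\<lambda>k. q ^ (\<alpha> i + k)) [0..<a ! i]) [0..<length a])"

lemma same_top_prod_list:
  assumes "\<And>j. j \<in> set js \<Longrightarrow> same_top N (\<lambda>_. 0) (d j) (f j) (g j)"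
  shows "same_top N (\<lambda>_. 0) (\<Sum>j\<leftarrow>js. d j) (\<Prod>j\<leftarrow>js. f j) (\<Prod>j\<leftarrow>js. g j)"
  using assms
proof (induction js)
  case (Cons j js)
  then show ?case
    using same_top_mult[of N "\<lambda>_. 0" "d j" "f j" "g j" "\<lambda>_. 0" "\<Sum>j\<leftarrow>js. d j"] by simp
qed (simp add: supp_in_1 same_top_refl)

section \<open>Supports and deformations of the factors of the Dyson product\<close>

lemma supp_in_ratio:
  assumes "i < N" "j < N" "i \<noteq> j"
  shows "supp_in N (\<lambda>l. if l = j then - 1 else 0) 0 (ratio_L i j :: 'k::comm_ring_1 laurent)"
proof -
  let ?e = "Poly_Mapping.single i 1 - Poly_Mapping.single j (1::int)"
  have "keys ?e \<subseteq> {..<N}"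
    using assms by (auto simp: in_keys_iff lookup_minus lookup_single when_def split: if_splits)
  moreover have "(\<Sum>l<N. lookup ?e l) = 0"
    using assms by (simp add: lookup_minus lookup_single when_def sum_subtractf)
  ultimately show ?thesis
    unfolding ratio_L_def using supp_in_single[of ?e N "1::'k"] assms
    by (auto elim!: supp_in_mono simp: lookup_minus lookup_single when_def)
qed

lemma supp_in_one_minus:
  fixes z :: "'k::comm_ring_1 laurent"
  assumes "supp_in N b 0 z" "\<And>l. b l \<le> 0"
  shows "supp_in N b 0 (1 - const_L c * z)"
proof -
  have "supp_in N b 0 (const_L c * z)"
    using supp_in_mult[OF supp_in_const[of N c] assms(1)] by simp
  moreover have "supp_in N b 0 (1 :: 'k laurent)"
    using supp_in_mono[OF supp_in_1] assms(2) by blast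
  ultimately show ?thesis by (rule supp_in_diff[rotated])
qed

lemma const_L_mult: "const_L (c * d) = const_L c * const_L (d :: 'k::comm_ring_1)"
  by (simp add: const_L_def mult_single)

lemma const_L_power: "const_L (c ^ k) = const_L (c :: 'k::comm_ring_1) ^ k"
  by (induction k) (simp_all add: const_L_mult, simp add: const_L_def)

lemma supp_in_qpoch:
  fixes z :: "'k::comm_ring_1 laurent"
  assumes "supp_in N b 0 z" "\<And>l. b l \<le> 0"
  shows "supp_in N (\<lambda>l. int k * b l) 0 (qpoch (const_L c * z) (const_L q) k)"
proof (induction k)
  case (Suc k)
  have "supp_in N b 0 (1 - const_L (c * q ^ k) * z)"
    by (rule supp_in_one_minus) fact+
  from supp_in_mult[OF Suc this] show ?case
    by (simp add: qpoch_Suc const_L_mult const_L_power algebra_simps)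
qed (simp add: supp_in_1)

text \<open>The term c / x_j has degree -1 and the exponent -1 in x_j, which x_i / x_j has already.
  Subtracting it in the last factor thus respects the lower bounds and leaves the part of degree 0
  unchanged.\<close>

lemma same_top_qpoch_shift:
  fixes q :: "'k::field"
  assumes "i < N" "j < N" "i \<noteq> j"
  shows "same_top N (\<lambda>l. if l = j then - int k else 0) 0 (qpoch (ratio_L i j) (const_L q) k)
    (qpoch_shift (ratio_L i j) (const_L q) k
       (const_L c * Poly_Mapping.single (Poly_Mapping.single j (- 1)) 1))"
proof (cases k)
  case 0
  then show ?thesis by (auto simp: qpoch_shift_def intro!: same_top_refl supp_in_mono[OF supp_in_1])
next
  case (Suc n)
  let ?b = "\<lambda>l. if l = j then - 1 else (0::int)"
  let ?y = "Poly_Mapping.single (Poly_Mapping.single j (- 1)) 1 :: 'k laurent"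
  have r: "supp_in N ?b 0 (ratio_L i j :: 'k laurent)" by (rule supp_in_ratio) fact+
  have "supp_in N ?b (- 1) ?y"
    using supp_in_single[of "Poly_Mapping.single j (- 1)" N "1::'k"] assms
    by (auto elim!: supp_in_mono simp: lookup_single when_def)
  then have "supp_in N ?b (- 1) (const_L c * ?y)"
    using supp_in_mult[OF supp_in_const[of N c]] by fastforce
  then have y: "supp_in N ?b (- 1) (- (const_L c * ?y))"
    by (rule supp_in_uminus)
  have "same_top N ?b 0 (1 - ratio_L i j * const_L q ^ n) (1 - ratio_L i j * const_L q ^ n - const_L c * ?y)"
    unfolding same_top_def using y supp_in_one_minus[OF r, of "q ^ n"]
    by (simp add: const_L_power mult.commute)
  moreover have "same_top N (\<lambda>l. int n * ?b l) 0 (qpoch (ratio_L i j) (const_L q) n) (qpoch (ratio_L i j) (const_L q) n)"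
    using supp_in_qpoch[OF r, of n 1 q] by (intro same_top_refl) (simp add: const_L_def)
  ultimately have "same_top N (\<lambda>l. int n * ?b l + ?b l) (0 + 0)
      (qpoch (ratio_L i j) (const_L q) n * (1 - ratio_L i j * const_L q ^ n))
      (qpoch (ratio_L i j) (const_L q) n * (1 - ratio_L i j * const_L q ^ n - const_L c * ?y))"
    by (intro same_top_mult)
  moreover have "(\<lambda>l. int n * ?b l + ?b l) = (\<lambda>l. if l = j then - int k else 0)"
    using Suc by auto
  ultimately show ?thesis using Suc by (simp add: qpoch_shift_def qpoch_Suc)
qed

text \<open>For \<open>i < m\<close> the factor \<open>q\<close> in the value of x_i cancels the
  q^-1 in \<open>xvars\<close>. Hence the exponents fill the interval from \<open>\<alpha> i\<close>
  to \<open>\<alpha> i + a ! i\<close>, independently of \<open>m\<close>.\<close>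

lemma eval_L_xvars:
  fixes q :: "'k::field"
  assumes "q \<noteq> 0" and x: "\<And>i. x i \<noteq> 0"
    "\<And>i. i < length a \<Longrightarrow> x i = (if i < m then q else 1) * q ^ \<alpha> i"
  shows "map (eval_L x) (xvars q a m) = scaled_powers q a \<alpha>"
  unfolding xvars_def scaled_powers_def map_concat map_map
proof (intro arg_cong[of _ _ concat] map_cong refl)
  fix i assume "i \<in> set [0..<length a]"
  then have i: "x i = (if i < m then q else 1) * q ^ \<alpha> i" using x(2) by simp
  have "q powi (int k - (if i < m then 1 else 0)) * x i = q ^ (\<alpha> i + k)" for k
    using assms(1) by (simp add: i power_int_diff power_add)
  then show "(map (eval_L x) \<circ> (\<lambda>i. map (\<lambda>k. const_L (q powi (int k - (if i < m then 1 else 0))) * var_L i)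
      [0..<a ! i])) i = map (\<lambda>k. q ^ (\<alpha> i + k)) [0..<a ! i]"
    by (simp add: eval_L_mult x(1))
qed

lemma supp_in_xvars:
  fixes q :: "'k::field"
  assumes "y \<in> set (xvars q a m)"
  shows "supp_in (length a) (\<lambda>i. 0) 1 y"
proof -
  have "\<exists>i c. i < length a \<and> y = const_L c * var_L i"
    using assms unfolding xvars_def by (auto; blast)
  then obtain i c where "i < length a" "y = const_L c * var_L i" by blast
  then show ?thesis
    using supp_in_mult[OF supp_in_const[of "length a" c] supp_in_var[of i "length a"]] by simp
qed

definition grid_point :: "'k::field \<Rightarrow> nat \<Rightarrow> (nat \<Rightarrow> nat) \<Rightarrow> nat \<Rightarrow> 'k"
  where "grid_point q m \<alpha> i = (if i < m then q else 1) * q ^ \<alpha> i"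

definition pair_factor :: "'k::field \<Rightarrow> nat list \<Rightarrow> nat \<Rightarrow> 'k \<Rightarrow> (nat \<Rightarrow> nat) \<Rightarrow> nat \<Rightarrow> nat \<Rightarrow> 'k"
  where "pair_factor q a m c \<alpha> i j =
    qpoch_shift (grid_point q m \<alpha> i / grid_point q m \<alpha> j) q (a ! i) (c / grid_point q m \<alpha> j) *
    qpoch (q * (grid_point q m \<alpha> j / grid_point q m \<alpha> i)) q (a ! j)"

text \<open>This is the Lagrange weight for the coefficient of X^d with the powers q^l, l in
  \<open>S\<close>, as nodes. It is taken at q^k instead of \<open>grid_point\<close>, whose extra
  factor \<open>q\<close> plays the part of \<open>t\<close> in \<open>CT_grid_sum\<close>.\<close>

definition grid_weight :: "'k::field \<Rightarrow> nat set \<Rightarrow> nat \<Rightarrow> nat \<Rightarrow> 'k"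
  where "grid_weight q S d k = (q ^ k) ^ d / (\<Prod>l\<in>S - {k}. q ^ k - q ^ l)"

definition grid_term :: "'k::field \<Rightarrow> nat list \<Rightarrow> nat list \<Rightarrow> nat list \<Rightarrow> nat \<Rightarrow> (nat \<Rightarrow> nat set) \<Rightarrow>
    (nat \<Rightarrow> 'k fps) \<Rightarrow> (nat \<Rightarrow> nat \<Rightarrow> 'k) \<Rightarrow> (nat \<Rightarrow> nat) \<Rightarrow> 'k"
  where "grid_term q a v lam m S E c \<alpha> =
    (\<Prod>i<length a. inverse (grid_point q m \<alpha> i ^ (v ! i))) *
    (\<Prod>r\<leftarrow>lam. (E r * complete_sym_fps (scaled_powers q a \<alpha>)) $ r) *
    (\<Prod>(i, j)\<in>index_pairs (length a). pair_factor q a m (c i j) \<alpha> i j) *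
    (\<Prod>i<length a. grid_weight q (S i) (v ! i + (sum_list a - a ! i)) (\<alpha> i))"

text \<open>
  The power series \<open>E r\<close> and the constants \<open>c i j\<close> are free parameters: they only change terms of
  lower degree.
\<close>

lemma D_coeff_grid_sum:
  fixes q :: "'k::field" and a v lam :: "nat list" and E :: "nat \<Rightarrow> 'k fps" and c :: "nat \<Rightarrow> nat \<Rightarrow> 'k" and m :: nat
  assumes q: "q \<noteq> 0" and len: "length v = length a" and lam: "sum_list lam = sum_list v"
    and S: "\<And>i. i < length a \<Longrightarrow>
      finite (S i) \<and> card (S i) = Suc (v ! i + (sum_list a - a ! i)) \<and> inj_on (\<lambda>k. q ^ k) (S i)"
    and E: "\<And>r. E r $ 0 = 1"
  shows "D_coeff q (map int v) lam a m = (\<Sum>\<alpha>\<in>PiE {..<length a} S. grid_term q a v lam m S E c \<alpha>)"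
proof -
  define x where "x = grid_point q m"
  define N where "N = length a"
  define X where "X = xvars q a m"
  \<comment> \<open>Since \<open>E r\<close> has constant term 1, \<open>h r\<close> is h_r(X) plus
    multiples of h_k(X) with k < r.\<close>
  define h where "h r = (\<Sum>k=0..r. const_L (E r $ k) * complete_sym (r - k) X)" for r
  define G where "G p = (case p of (i, j) \<Rightarrow>
    qpoch (ratio_L i j) (const_L q) (a ! i) * qpoch (const_L q * ratio_L j i) (const_L q) (a ! j))"
    for p :: "nat \<times> nat"
  define G' where "G' p = (case p of (i, j) \<Rightarrow>
    qpoch_shift (ratio_L i j) (const_L q) (a ! i)
      (const_L (c i j) * Poly_Mapping.single (Poly_Mapping.single j (- 1)) 1) *
    qpoch (const_L q * ratio_L j i) (const_L q) (a ! j))"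
    for p :: "nat \<times> nat"
  define P where "P = monom_neg_L (map int v) * prod_list (map (\<lambda>r. complete_sym r X) lam) * prod G (index_pairs N)"
  define P' where "P' = monom_neg_L (map int v) * prod_list (map h lam) * prod G' (index_pairs N)"
  define b where "b p l = (case p of (i, j) \<Rightarrow>
    (if l = j then - int (a ! i) else 0) + (if l = i then - int (a ! j) else 0))"
    for p :: "nat \<times> nat" and l :: nat
  define b0 where "b0 l = (if l < N then - int (v ! l) else 0)" for l

  have "same_top N (\<lambda>_. 0) (int r) (complete_sym r X) (h r)" for r
    unfolding same_top_def
  proof
    have cs: "supp_in N (\<lambda>_. 0) (int k) (complete_sym k X)" for k
      unfolding N_def X_def by (intro supp_in_complete_sym supp_in_xvars)
    then show "supp_in N (\<lambda>_. 0) (int r) (complete_sym r X)" .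
    have "h r - complete_sym r X = (\<Sum>k\<in>{Suc 0..r}. const_L (E r $ k) * complete_sym (r - k) X)"
      by (simp add: h_def sum.atLeast_Suc_atMost[of 0] E const_L_def)
    also have "supp_in N (\<lambda>_. 0) (int r - 1) \<dots>"
    proof (rule supp_in_sum)
      fix k assume "k \<in> {Suc 0..r}"
      then show "supp_in N (\<lambda>_. 0) (int r - 1) (const_L (E r $ k) * complete_sym (r - k) X)"
        using supp_in_mult[OF supp_in_const[of N "E r $ k"] cs[of "r - k"]]
        by (elim supp_in_mono) auto
    qed
    finally show "supp_in N (\<lambda>_. 0) (int r - 1) (h r - complete_sym r X)" .
  qed
  then have top_h: "same_top N (\<lambda>_. 0) (int (sum_list lam)) (\<Prod>r\<leftarrow>lam. complete_sym r X) (\<Prod>r\<leftarrow>lam. h r)"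
    using same_top_prod_list[of lam N int "\<lambda>r. complete_sym r X" h] by (simp add: sum_list_of_nat[symmetric] o_def)

  have "same_top N (b p) 0 (G p) (G' p)" if "p \<in> index_pairs N" for p
  proof -
    obtain i j where p: "p = (i, j)" "i < j" "j < N" using \<open>p \<in> _\<close> by (auto simp: index_pairs_def)
    have "supp_in N (\<lambda>l. int (a ! j) * (if l = i then - 1 else 0)) 0
        (qpoch (const_L q * ratio_L j i) (const_L q) (a ! j))"
      using p by (intro supp_in_qpoch supp_in_ratio) auto
    then have "supp_in N (\<lambda>l. if l = i then - int (a ! j) else 0) 0
        (qpoch (const_L q * ratio_L j i) (const_L q) (a ! j))"
      by (elim supp_in_mono) auto
    then have "same_top N (\<lambda>l. (if l = j then - int (a ! i) else 0) + (if l = i then - int (a ! j) else 0))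
        (0 + 0) (G p) (G' p)"
      unfolding G_def G'_def p prod.case using p
      by (intro same_top_mult[OF same_top_qpoch_shift same_top_refl]) auto
    then show ?thesis by (simp add: b_def[abs_def] p(1))
  qed
  then have top_G: "same_top N (\<lambda>l. \<Sum>p\<in>index_pairs N. b p l) 0 (prod G (index_pairs N)) (prod G' (index_pairs N))"
    using same_top_prod[of "index_pairs N" N b "\<lambda>_. 0" G G'] by simp

  have sum_v: "int (sum_list v) = (\<Sum>i<N. int (v ! i))"
    using len by (simp add: N_def sum_list_sum_nth atLeast0LessThan)
  have sum_a: "int (sum_list a) = (\<Sum>i<N. int (a ! i))"
    by (simp add: N_def sum_list_sum_nth atLeast0LessThan)
  have "supp_in N b0 (- int (sum_list v)) (monom_neg_L (map int v) :: 'k laurent)"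
  proof -
    let ?e = "\<Sum>i<N. Poly_Mapping.single i (- int (v ! i))"
    have lk: "lookup ?e l = b0 l" for l
      by (simp add: lookup_sum lookup_single when_def b0_def)
    have "keys ?e \<subseteq> {..<N}" unfolding in_keys_iff subset_iff lk by (auto simp: b0_def)
    from supp_in_single[OF this, of "1::'k"]
    have "supp_in N (lookup ?e) (\<Sum>l<N. lookup ?e l) (monom_neg_L (map int v) :: 'k laurent)"
      using len by (simp add: monom_neg_L_def N_def)
    then show ?thesis
    proof (rule supp_in_mono)
      show "b0 l \<le> lookup ?e l" for l by (simp add: lk)
      show "(\<Sum>l<N. lookup ?e l) \<le> - int (sum_list v)"
        by (simp only: lk) (simp add: b0_def sum_v sum_negf)
    qed
  qed
  then have top: "same_top N (\<lambda>l. b0 l + 0 + (\<Sum>p\<in>index_pairs N. b p l))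
      (- int (sum_list v) + int (sum_list lam) + 0) P P'"
    unfolding P_def P'_def by (rule same_top_mult[OF same_top_mult[OF same_top_refl top_h] top_G])
  then have top': "same_top N (\<lambda>l. b0 l + 0 + (\<Sum>p\<in>index_pairs N. b p l)) 0 P P'"
    using lam by simp
  have a_le: "a ! i \<le> sum_list a" if "i < N" for i
    using that by (simp add: N_def elem_le_sum_list)
  have "supp_in N (\<lambda>l. b0 l + 0 + (\<Sum>p\<in>index_pairs N. b p l)) 0 P'"
    by (rule same_top_supp_in[OF top'])
  then have supp: "supp_in N (\<lambda>l. - int (v ! l + (sum_list a - a ! l))) 0 P'"
  proof (rule supp_in_mono)
    fix l
    show "- int (v ! l + (sum_list a - a ! l)) \<le> b0 l + 0 + (\<Sum>p\<in>index_pairs N. b p l)"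
    proof (cases "l < N")
      case True
      have "(\<Sum>p\<in>index_pairs N. b p l) = (\<Sum>i<N. - int (a ! i)) - (- int (a ! l))"
        unfolding b_def sum_index_pairs_incident[OF True, of "\<lambda>i. - int (a ! i)", symmetric] ..
      then show ?thesis using True a_le[OF True] by (simp add: b0_def sum_negf sum_a[symmetric])
    next
      case False
      then have "(\<Sum>p\<in>index_pairs N. b p l) = 0"
        by (intro sum.neutral) (auto simp: b_def index_pairs_def)
      then show ?thesis using False by (simp add: b0_def)
    qed
  qed simp

  have "D_coeff q (map int v) lam a m = CT P"
    by (simp add: D_coeff_def P_def G_def[abs_def] index_pairs_def complete_sym_partition_def X_def N_def)
  also have "\<dots> = CT P'"
    by (rule same_top_CT[OF top', symmetric])
  also have "\<dots> = (\<Sum>\<alpha>\<in>PiE {..<N} S. eval_L (\<lambda>i. if i < N then (if i < m then q else 1) * q ^ \<alpha> i else 1) P' *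
    (\<Prod>i<N. (q ^ \<alpha> i) ^ (v ! i + (sum_list a - a ! i)) / (\<Prod>\<beta>\<in>S i - {\<alpha> i}. q ^ \<alpha> i - q ^ \<beta>)))"
    by (rule CT_grid_sum[OF supp]) (use S q in \<open>auto simp: N_def\<close>)
  also have "\<dots> = (\<Sum>\<alpha>\<in>PiE {..<N} S.
    (\<Prod>i<N. inverse (x \<alpha> i ^ (v ! i))) *
    (\<Prod>r\<leftarrow>lam. (E r * complete_sym_fps (scaled_powers q a \<alpha>)) $ r) *
    (\<Prod>(i, j)\<in>index_pairs N.
      qpoch_shift (x \<alpha> i / x \<alpha> j) q (a ! i) (c i j / x \<alpha> j) * qpoch (q * (x \<alpha> j / x \<alpha> i)) q (a ! j)) *
    (\<Prod>i<N. (q ^ \<alpha> i) ^ (v ! i + (sum_list a - a ! i)) / (\<Prod>\<beta>\<in>S i - {\<alpha> i}. q ^ \<alpha> i - q ^ \<beta>)))"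
  proof (intro sum.cong refl arg_cong2[of _ _ _ _ "(*)"])
    fix \<alpha>
    define y where "y = (\<lambda>i. if i < N then (if i < m then q else 1) * q ^ \<alpha> i else 1)"
    have y: "\<And>i. y i \<noteq> 0" "\<And>i. i < N \<Longrightarrow> y i = x \<alpha> i" using q by (auto simp: y_def x_def grid_point_def)
    have "eval_L y (monom_neg_L (map int v)) = (\<Prod>i<N. inverse (x \<alpha> i ^ (v ! i)))"
      using len y by (simp add: eval_L_monom_neg N_def power_int_minus)
    moreover have "eval_L y (h r) = (E r * complete_sym_fps (scaled_powers q a \<alpha>)) $ r" for r
    proof -
      have "map (eval_L y) X = scaled_powers q a \<alpha>"
        unfolding X_def by (rule eval_L_xvars[OF q y(1)]) (simp add: y_def N_def)
      then show ?thesis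
        by (simp add: h_def eval_L_sum eval_L_mult[OF y(1)] eval_L_complete_sym[OF y(1)] fps_mult_nth complete_sym_fps_def)
    qed
    moreover have "eval_L y (G' (i, j)) = qpoch_shift (x \<alpha> i / x \<alpha> j) q (a ! i) (c i j / x \<alpha> j) *
        qpoch (q * (x \<alpha> j / x \<alpha> i)) q (a ! j)" if "(i, j) \<in> index_pairs N" for i j
    proof -
      have ij: "i < N" "j < N" using that by (auto simp: index_pairs_def)
      show ?thesis
        unfolding G'_def prod.case qpoch_shift_def
        by (simp add: eval_L_mult[OF y(1)] eval_L_qpoch[OF y(1)] eval_L_diff eval_L_ratio[OF y(1)] y(2)[OF ij(1)] y(2)[OF ij(2)]
            eval_L_power[OF y(1)] power_int_minus divide_inverse)
    qed
    ultimately have evals: "eval_L y (monom_neg_L (map int v)) = (\<Prod>i<N. inverse (x \<alpha> i ^ (v ! i)))"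
      "\<And>r. eval_L y (h r) = (E r * complete_sym_fps (scaled_powers q a \<alpha>)) $ r"
      "\<And>i j. (i, j) \<in> index_pairs N \<Longrightarrow> eval_L y (G' (i, j)) =
        qpoch_shift (x \<alpha> i / x \<alpha> j) q (a ! i) (c i j / x \<alpha> j) * qpoch (q * (x \<alpha> j / x \<alpha> i)) q (a ! j)"
      by blast+
    have "eval_L y P' = (\<Prod>i<N. inverse (x \<alpha> i ^ (v ! i))) *
        (\<Prod>r\<leftarrow>lam. (E r * complete_sym_fps (scaled_powers q a \<alpha>)) $ r) *
        (\<Prod>(i, j)\<in>index_pairs N.
          qpoch_shift (x \<alpha> i / x \<alpha> j) q (a ! i) (c i j / x \<alpha> j) * qpoch (q * (x \<alpha> j / x \<alpha> i)) q (a ! j))"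
      unfolding P'_def eval_L_mult[OF y(1)] eval_L_prod[OF y(1)] eval_L_prod_list[OF y(1)] map_map o_def evals(1,2)
      by (intro arg_cong2[of _ _ _ _ "(*)"] refl prod.cong) (auto simp: evals(3))
    then show "eval_L (\<lambda>i. if i < N then (if i < m then q else 1) * q ^ \<alpha> i else 1) P' = \<dots>"
      by (simp add: y_def)
  qed
  finally show ?thesis
    by (simp add: N_def x_def grid_term_def pair_factor_def grid_weight_def)
qed


section \<open>Products of powers of \<open>q\<close>\<close>

lemma qpoch_eq_0:
  assumes "k < n" "z * q ^ k = 1"
  shows "qpoch z q n = 0"
  unfolding qpoch_def using assms by (intro prod_zero) auto

lemma qpoch_add: "qpoch z q (k + l) = qpoch z q k * qpoch (z * q ^ k) q l"
  by (induction l) (simp_all add: qpoch_Suc power_add mult_ac)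

text \<open>Pulling out -q^k leaves 1 - q^(n+b-k), and n+b-k runs through b+1, ..., n+b in reverse
  order.\<close>

lemma prod_diff_powers_eq_qpoch:
  "(\<Prod>k<n. q ^ (n + b) - q ^ k) = (\<Prod>k<n. - (q ^ k)) * qpoch (q ^ Suc b) q n"
proof -
  have "qpoch (q ^ Suc b) q n = (\<Prod>k<n. 1 - q ^ (n + b - k))"
    unfolding qpoch_def
    by (subst prod.nat_diff_reindex[symmetric])
       (auto simp flip: power_add power_Suc intro!: prod.cong arg_cong[of _ _ "(^) q"])
  moreover have "q ^ (n + b) - q ^ k = - (q ^ k) * (1 - q ^ (n + b - k))" if "k < n" for k
    using that by (simp add: algebra_simps flip: power_add)
  ultimately show ?thesis by (simp add: prod.distrib[symmetric])
qed

text \<open>Each factor, linear in y, is normalized to y minus its zero; the zeros are the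
  \<open>n\<close> powers of \<open>q\<close> just below q^L. In this form products for adjacent
  ranges of zeros can be joined.\<close>

lemma prod_diff_powers_shift:
  fixes y :: "'a::comm_ring_1"
  assumes "n \<le> L"
  shows "(\<Prod>k<n. q ^ L - y * q ^ Suc k) = (\<Prod>k<n. - (q ^ Suc k)) * (\<Prod>l\<in>{L - n..<L}. y - q ^ l)"
  using assms
proof (induction n)
  case (Suc n)
  have "q ^ L = q ^ Suc n * q ^ (L - Suc n)" using Suc.prems by (metis le_add_diff_inverse power_add)
  then have "q ^ L - y * q ^ Suc n = - (q ^ Suc n) * (y - q ^ (L - Suc n))" by (simp add: algebra_simps)
  moreover have "{L - Suc n..<L} = insert (L - Suc n) {L - n..<L}" using Suc.prems by auto
  ultimately show ?case using Suc by (simp add: mult_ac)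
qed simp

lemma power_mult_qpoch_divide:
  fixes y :: "'k::field"
  assumes "y \<noteq> 0"
  shows "y ^ k * qpoch (z / y) q k = (\<Prod>i<k. y - z * q ^ i)"
  using assms by (induction k) (simp_all add: qpoch_Suc field_simps)

lemma power_mult_qpoch_divide':
  fixes w :: "'k::field"
  assumes "w \<noteq> 0"
  shows "w ^ k * qpoch (q * (y / w)) q k = (\<Prod>i<k. w - y * q ^ Suc i)"
  using power_mult_qpoch_divide[OF assms, of k "q * y" q] by (simp add: mult_ac)

lemma prod_shift_lessThan:
  fixes s b :: nat
  shows "(\<Prod>k<b. f (s + k)) = (\<Prod>k\<in>{s..<s + b}. f k)"
  using prod.shift_bounds_nat_ivl[of f 0 s b] by (simp add: atLeast0LessThan add.commute)

lemma prod_scaled_powers: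
  fixes g :: "'k::field \<Rightarrow> 'b::comm_monoid_mult"
  shows "(\<Prod>y\<leftarrow>scaled_powers q a \<alpha>. g y) = (\<Prod>i<length a. \<Prod>k\<in>{\<alpha> i..<\<alpha> i + a ! i}. g (q ^ k))"
proof -
  have 1: "(\<Prod>k\<leftarrow>[0..<N]. f k) = (\<Prod>k<N. f k)" for f :: "nat \<Rightarrow> 'b" and N
    by (simp add: prod.distinct_set_conv_list[symmetric] atLeast0LessThan)
  have 2: "(\<Prod>y\<leftarrow>concat xss. g y) = (\<Prod>xs\<leftarrow>xss. \<Prod>y\<leftarrow>xs. g y)" for xss
    by (induction xss) simp_all
  have 3: "(\<Prod>k<b. g (q ^ (s + k))) = (\<Prod>k\<in>{s..<s + b}. g (q ^ k))" for s b
    by (rule prod_shift_lessThan)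
  show ?thesis
    by (simp add: scaled_powers_def 2 o_def 1 3)
qed

definition linear_fps :: "'k::field \<Rightarrow> nat \<Rightarrow> 'k fps"
  where "linear_fps q k = 1 - fps_const (q ^ k) * fps_X"

lemma prod_linear_fps_nth_0 [simp]: "(\<Prod>k\<in>A. linear_fps q k) $ 0 = 1"
  by (induction A rule: infinite_finite_induct) (simp_all add: linear_fps_def)

section \<open>Disjoint intervals of exponents\<close>

definition intervals_disjoint :: "nat list \<Rightarrow> (nat \<Rightarrow> nat) \<Rightarrow> bool"
  where "intervals_disjoint a \<alpha> \<longleftrightarrow> (\<forall>i j. i < j \<and> j < length a \<longrightarrow>
    {\<alpha> i..<\<alpha> i + a ! i} \<inter> {\<alpha> j..<\<alpha> j + a ! j} = {})"

definition intervals_Un :: "nat list \<Rightarrow> (nat \<Rightarrow> nat) \<Rightarrow> nat set"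
  where "intervals_Un a \<alpha> = (\<Union>i<length a. {\<alpha> i..<\<alpha> i + a ! i})"

lemma finite_intervals_Un [simp]: "finite (intervals_Un a \<alpha>)"
  by (simp add: intervals_Un_def)

lemma prod_intervals_Un:
  assumes "intervals_disjoint a \<alpha>"
  shows "(\<Prod>k\<in>intervals_Un a \<alpha>. g k) = (\<Prod>i<length a. \<Prod>k\<in>{\<alpha> i..<\<alpha> i + a ! i}. g k)"
  unfolding intervals_Un_def
proof (rule prod.UNION_disjoint)
  show "\<forall>i\<in>{..<length a}. \<forall>j\<in>{..<length a}. i \<noteq> j \<longrightarrow>
      {\<alpha> i..<\<alpha> i + a ! i} \<inter> {\<alpha> j..<\<alpha> j + a ! j} = {}"
    using assms unfolding intervals_disjoint_def
    by (metis Int_commute lessThan_iff linorder_neqE_nat)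
qed auto

lemma card_intervals_Un:
  assumes "intervals_disjoint a \<alpha>"
  shows "card (intervals_Un a \<alpha>) = sum_list a"
proof -
  have "card (intervals_Un a \<alpha>) = (\<Sum>i<length a. card {\<alpha> i..<\<alpha> i + a ! i})"
    unfolding intervals_Un_def
  proof (rule card_UN_disjoint)
    show "\<forall>i\<in>{..<length a}. \<forall>j\<in>{..<length a}. i \<noteq> j \<longrightarrow>
        {\<alpha> i..<\<alpha> i + a ! i} \<inter> {\<alpha> j..<\<alpha> j + a ! j} = {}"
      using assms unfolding intervals_disjoint_def
      by (metis Int_commute lessThan_iff linorder_neqE_nat)
  qed auto
  then show ?thesis by (simp add: sum_list_sum_nth atLeast0LessThan)
qed

text \<open>For disjoint intervals the factors 1 - q^k T are indexed by a set of exponents, so that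
  cancelling them against another such product amounts to a difference of sets.\<close>

lemma complete_sym_fps_scaled_powers:
  assumes "intervals_disjoint a \<alpha>"
  shows "complete_sym_fps (scaled_powers q a \<alpha>) * (\<Prod>k\<in>intervals_Un a \<alpha>. linear_fps q k) = 1"
  using complete_sym_fps_mult[of "scaled_powers q a \<alpha>"]
  by (simp add: prod_intervals_Un[OF assms] prod_scaled_powers linear_fps_def)

text \<open>If the interval of \<open>j\<close> starts at least \<delta> after that of
  \<open>i\<close>, a factor of the first symbol vanishes, otherwise one of the second. For \<delta>
  = 1 the vanishing factor of the first symbol is never its last one, so the deformation is harmless
  there; this is why \<open>c\<close> may be nonzero only if
  \<open>i < m \<and> m \<le> j\<close>.\<close>

lemma pair_factor_eq_0:
  assumes q: "q \<noteq> 0" and "i < j"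
    and overlap: "{\<alpha> i..<\<alpha> i + a ! i} \<inter> {\<alpha> j..<\<alpha> j + a ! j} \<noteq> {}"
    and c: "c \<noteq> 0 \<Longrightarrow> i < m \<and> m \<le> j"
  shows "pair_factor q a m c \<alpha> i j = 0"
proof -
  define z where "z = grid_point q m \<alpha> i / grid_point q m \<alpha> j"
  define z' where "z' = grid_point q m \<alpha> j / grid_point q m \<alpha> i"
  \<comment> \<open>At the grid point, x_i / x_j is q to the power \<delta> + \<alpha>_i -
    \<alpha>_j.\<close>
  define \<delta> where "\<delta> = (if i < m \<and> m \<le> j then 1 else 0 :: nat)"
  have z: "z * q ^ \<alpha> j = q ^ \<delta> * q ^ \<alpha> i" and z': "z' * q ^ (\<delta> + \<alpha> i) = q ^ \<alpha> j"
    using q \<open>i < j\<close> by (auto simp: z_def z'_def \<delta>_def grid_point_def field_simps)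
  have red: "pair_factor q a m c \<alpha> i j =
      qpoch_shift z q (a ! i) (c / grid_point q m \<alpha> j) * qpoch (q * z') q (a ! j)"
    by (simp add: pair_factor_def z_def z'_def)
  from overlap obtain t where "t \<in> {\<alpha> i..<\<alpha> i + a ! i} \<inter> {\<alpha> j..<\<alpha> j + a ! j}" by blast
  then have t: "\<alpha> i \<le> t" "t < \<alpha> i + a ! i" "\<alpha> j \<le> t" "t < \<alpha> j + a ! j" by auto
  consider (1) "\<delta> = 0" "\<alpha> i \<le> \<alpha> j" | (2) "\<delta> = 1" "\<alpha> i < \<alpha> j" | (3) "\<alpha> j + 1 \<le> \<alpha> i + \<delta>"
  proof -
    have "\<delta> = 0 \<and> \<alpha> i \<le> \<alpha> j \<or> \<delta> = 1 \<and> \<alpha> i < \<alpha> j \<or> \<alpha> j + 1 \<le> \<alpha> i + \<delta>"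
      unfolding \<delta>_def by auto
    then show ?thesis using that by blast
  qed
  then show ?thesis
  proof cases
    case 1
    have "c = 0" using c 1 by (auto simp: \<delta>_def split: if_splits)
    have "q ^ \<alpha> j = q ^ (\<alpha> j - \<alpha> i) * q ^ \<alpha> i" using 1 by (simp flip: power_add)
    then have "z * q ^ (\<alpha> j - \<alpha> i) = 1" using z q 1 by simp
    then have "qpoch z q (a ! i) = 0" using t by (intro qpoch_eq_0) auto
    then show ?thesis by (subst red) (simp add: \<open>c = 0\<close>)
  next
    case 2
    have "q ^ \<alpha> j = q ^ (\<alpha> j - \<alpha> i - 1) * (q * q ^ \<alpha> i)" using 2 by (simp flip: power_add power_Suc)
    then have "z * q ^ (\<alpha> j - \<alpha> i - 1) = 1" using z q 2 by simp
    then have "qpoch z q (a ! i - 1) = 0" using t 2 by (intro qpoch_eq_0) auto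
    moreover have "a ! i \<noteq> 0" using t by auto
    ultimately show ?thesis by (simp add: red qpoch_shift_def)
  next
    case 3
    have "q * q ^ (\<alpha> i + \<delta> - \<alpha> j - 1) * q ^ \<alpha> j = q ^ (\<delta> + \<alpha> i)"
    proof -
      have "\<delta> + \<alpha> i = Suc (\<alpha> i + \<delta> - \<alpha> j - 1) + \<alpha> j" using 3 by arith
      then show ?thesis by (metis power_Suc power_add)
    qed
    then have "z' * (q * q ^ (\<alpha> i + \<delta> - \<alpha> j - 1) * q ^ \<alpha> j) = q ^ \<alpha> j"
      using z' by (simp only:)
    then have "(q * z' * q ^ (\<alpha> i + \<delta> - \<alpha> j - 1)) * q ^ \<alpha> j = q ^ \<alpha> j"
      by (simp only: mult_ac)
    then have "q * z' * q ^ (\<alpha> i + \<delta> - \<alpha> j - 1) = 1"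
      using power_not_zero[OF q] by (simp only: mult_cancel_right2) blast
    moreover have "\<alpha> i + \<delta> - \<alpha> j - 1 < a ! j"
      using t 3 by (auto simp: \<delta>_def split: if_splits)
    ultimately show ?thesis by (simp add: red qpoch_eq_0)
  qed
qed

lemma prod_index_pairs_Suc:
  "(\<Prod>(i, j)\<in>index_pairs (Suc n). f i j) =
    (\<Prod>j<n. f 0 (Suc j)) * (\<Prod>(i, j)\<in>index_pairs n. f (Suc i) (Suc j))"
proof -
  have "index_pairs (Suc n) = Pair 0 ` (Suc ` {..<n}) \<union> map_prod Suc Suc ` index_pairs n"
  proof (intro equalityI subsetI)
    fix p assume p: "p \<in> index_pairs (Suc n)"
    then obtain i j where "p = (i, Suc j)" "i < Suc j" "j < n"
      by (cases p; cases "snd p") (auto simp: index_pairs_def)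
    then show "p \<in> Pair 0 ` (Suc ` {..<n}) \<union> map_prod Suc Suc ` index_pairs n"
      by (cases i) (auto simp: index_pairs_def image_iff)
  qed (auto simp: index_pairs_def)
  moreover have "Pair 0 ` (Suc ` {..<n}) \<inter> map_prod Suc Suc ` index_pairs n = {}" by auto
  ultimately have "(\<Prod>(i, j)\<in>index_pairs (Suc n). f i j) =
      (\<Prod>(i, j)\<in>Pair 0 ` (Suc ` {..<n}). f i j) * (\<Prod>(i, j)\<in>map_prod Suc Suc ` index_pairs n. f i j)"
    by (simp add: prod.union_disjoint)
  also have "(\<Prod>(i, j)\<in>map_prod Suc Suc ` index_pairs n. f i j) = (\<Prod>(i, j)\<in>index_pairs n. f (Suc i) (Suc j))"
    by (subst prod.reindex) (auto simp: inj_on_def intro!: prod.cong)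
  finally show ?thesis by (simp add: prod.reindex inj_on_def)
qed


section \<open>The recursion\<close>

text \<open>Maximality and multiplicity one of v_0 enter as \<open>v_less\<close>. By
  \<open>q_powers\<close>, the powers of \<open>q\<close> are distinct and the symbols (q;q)_k are
  nonzero. If v_0 = a_0 = 0, then \<open>n = 0\<close>, the left-hand side is 1 and the q-binomial
  coefficient is 0; \<open>pos\<close> excludes this case.\<close>

locale dyson_recursion =
  fixes q :: "'k::field" and n m :: nat and a v :: "nat list"
  assumes q0: "q \<noteq> 0"
    and q_powers: "\<And>k::nat. k > 0 \<Longrightarrow> q ^ k \<noteq> 1"
    and len_a: "length a = Suc n" and len_v: "length v = Suc n"
    and v_less: "\<And>j. j < n \<Longrightarrow> v ! Suc j < v ! 0"
    and pos: "v ! 0 > 0 \<or> a ! 0 > 0"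
    and m: "0 < m" "m \<le> Suc n"
begin

declare len_a [simp] len_v [simp]

definition "N = sum_list (tl a) + v ! 0"

text \<open>
  The grid for \<open>x\<^sub>j\<close> with \<open>j > 0\<close> consists of the grid used for the shorter sequences and of a block
  on which the factors involving \<open>x\<^sub>0\<close> vanish as soon as \<open>x\<^sub>0\<close> takes its last value.
\<close>

definition small_grid :: "nat \<Rightarrow> nat set"
  where "small_grid j = {..v ! Suc j + (sum_list (tl a) - a ! Suc j)}"

definition block :: "nat \<Rightarrow> nat set"
  where "block j = {N - a ! Suc j..<N + a ! 0 - a ! Suc j}"

definition grid :: "nat \<Rightarrow> nat set"
  where "grid i = (case i of 0 \<Rightarrow> {..N} | Suc j \<Rightarrow> small_grid j \<union> block j)"

text \<open>
  The coefficient of \<open>T\<^sup>r\<close> in \<open>E r\<close> times the generating function of the \<open>h\<^sub>k(X)\<close> is \<open>h\<^sub>r[X - Y]\<close>. For \<open>r\<close>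
  maximal, \<open>Y\<close> consists of all powers of \<open>q\<close> that occur in \<open>X\<close> at points where \<open>x\<^sub>0\<close> does not take its last
  value; for the other \<open>r\<close> it removes the variables that \<open>x\<^sub>0\<close> contributes at its last value.
\<close>

definition E :: "nat \<Rightarrow> 'k fps"
  where "E r = (if r = v ! 0 then \<Prod>k<N + a ! 0 - 1. linear_fps q k
    else \<Prod>k\<in>{N..<N + a ! 0}. linear_fps q k)"

text \<open>
  At the last value of \<open>x\<^sub>0\<close>, this moves the zero of the last factor of \<open>(x\<^sub>0/x\<^sub>j)\<close> from the exponent
  \<open>N + a\<^sub>0\<close> to \<open>N - a\<^sub>j\<close>, which makes the zeros independent of the position of \<open>j\<close> relative to \<open>m\<close>.
\<close>

definition c :: "nat \<Rightarrow> nat \<Rightarrow> 'k"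
  where "c i j = (if i = 0 \<and> m \<le> j then q ^ (N - a ! j) - q ^ (N + a ! 0) else 0)"

abbreviation big_term :: "(nat \<Rightarrow> nat) \<Rightarrow> 'k"
  where "big_term \<equiv> grid_term q a v (v ! 0 # decr (tl v)) m grid E c"

abbreviation small_term :: "(nat \<Rightarrow> nat) \<Rightarrow> 'k"
  where "small_term \<equiv> grid_term q (tl a) (tl v) (decr (tl v)) (m - 1) small_grid (\<lambda>_. 1) (\<lambda>_ _. 0)"

lemma power_q_inj: "inj ((^) q)"
proof (rule injI)
  have *: "q ^ k \<noteq> q ^ l" if "k < l" for k l
  proof
    assume "q ^ k = q ^ l"
    also have "q ^ l = q ^ k * q ^ (l - k)" using that by (simp flip: power_add)
    finally have "q ^ (l - k) = 1" using q0 by simp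
    with q_powers[of "l - k"] that show False by simp
  qed
  fix k l assume "q ^ k = q ^ l"
  then show "k = l" using *[of k l] *[of l k] by (cases k l rule: linorder_cases) auto
qed

lemma power_q_eq_iff [simp]: "q ^ k = q ^ l \<longleftrightarrow> k = l"
  using power_q_inj by (auto simp: inj_def)

lemma tl_nth [simp]: "j < n \<Longrightarrow> tl a ! j = a ! Suc j" "j < n \<Longrightarrow> tl v ! j = v ! Suc j"
  using len_a len_v by (simp_all add: nth_tl)

lemma len_tl [simp]: "length (tl a) = n" "length (tl v) = n"
  using len_a len_v by simp_all

lemma sum_list_a: "sum_list a = a ! 0 + sum_list (tl a)"
  using len_a by (cases a) auto

lemma a_le: "j < n \<Longrightarrow> a ! Suc j \<le> sum_list (tl a)"
  by (metis elem_le_sum_list len_tl(1) tl_nth(1))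

lemma a_le_N: "j < n \<Longrightarrow> a ! Suc j \<le> N"
  using a_le[of j] by (simp add: N_def)

text \<open>This is where v_j < v_0 separates the two pieces of the grid. It also shows that an
  interval starting in \<open>small_grid j\<close> ends below \<open>N\<close>.\<close>

lemma small_less_block:
  assumes "j < n" shows "v ! Suc j + (sum_list (tl a) - a ! Suc j) < N - a ! Suc j"
  using a_le[OF assms] v_less[OF assms] by (simp add: N_def)

lemma small_block_disjoint: "j < n \<Longrightarrow> small_grid j \<inter> block j = {}"
  using small_less_block[of j] by (auto simp: small_grid_def block_def)

lemma finite_grid: "finite (small_grid j)" "finite (block j)" "finite (grid i)"
  by (simp_all add: small_grid_def block_def grid_def split: nat.split)

text \<open>Adjoining x_0 lowers the bound on the exponent of each other variable by a_0, which is
  the size of \<open>block j\<close>. For x_0 itself the bound is -N.\<close>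

lemma card_grid:
  assumes "i < Suc n"
  shows "card (grid i) = Suc (v ! i + (sum_list a - a ! i))"
proof (cases i)
  case 0
  then show ?thesis by (simp add: grid_def N_def sum_list_a)
next
  case (Suc j)
  then have j: "j < n" using assms by simp
  have "card (grid i) = card (small_grid j) + card (block j)"
    using small_block_disjoint[OF j] Suc by (simp add: grid_def card_Un_disjoint finite_grid)
  then show ?thesis using Suc a_le[OF j] a_le_N[OF j] by (simp add: small_grid_def block_def sum_list_a)
qed

section \<open>Both Dyson coefficients as grid sums\<close>

lemma D_coeff_big:
  "D_coeff q (map int v) (v ! 0 # decr (tl v)) a m = (\<Sum>\<alpha>\<in>PiE {..<Suc n} grid. big_term \<alpha>)"
proof -
  have "sum_list (v ! 0 # decr (tl v)) = sum_list v"
    using len_v by (cases v) (simp_all add: decr_def sum_list_rev flip: sum_mset_sum_list)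
  then show ?thesis
    using D_coeff_grid_sum[of q v a "v ! 0 # decr (tl v)" grid E m c] q0 len_a len_v
      card_grid finite_grid inj_on_subset[OF power_q_inj]
    by (simp add: E_def)
qed

lemma D_coeff_small:
  "D_coeff q (map int (tl v)) (decr (tl v)) (tl a) (m - 1) =
    (\<Sum>\<alpha>\<in>PiE {..<n} small_grid. small_term \<alpha>)"
proof -
  have "sum_list (decr (tl v)) = sum_list (tl v)"
    by (simp add: decr_def sum_list_rev flip: sum_mset_sum_list)
  moreover have "card (small_grid j) = Suc (tl v ! j + (sum_list (tl a) - tl a ! j))" if "j < n" for j
    using that by (simp add: small_grid_def)
  ultimately show ?thesis
    using D_coeff_grid_sum[of q "tl v" "tl a" "decr (tl v)" small_grid "\<lambda>_. 1" "m - 1" "\<lambda>_ _. 0"] q0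
      finite_grid inj_on_subset[OF power_q_inj]
    by (simp add: len_a len_v)
qed

text \<open>Overlapping intervals kill a pair factor. For disjoint ones all of X lies in Y, so the
  generating function of the h_r[X - Y] is a polynomial of degree v_0 - 1, and its coefficient at
  v_0 is 0.\<close>

lemma big_term_eq_0:
  assumes \<alpha>: "\<alpha> \<in> PiE {..<Suc n} grid" and "\<alpha> 0 < N \<or> a ! 0 = 0"
  shows "big_term \<alpha> = 0"
proof (cases "intervals_disjoint a \<alpha>")
  case False
  then obtain i j where ij: "i < j" "j < length a"
    "{\<alpha> i..<\<alpha> i + a ! i} \<inter> {\<alpha> j..<\<alpha> j + a ! j} \<noteq> {}"
    by (auto simp: intervals_disjoint_def)
  have "pair_factor q a m (c i j) \<alpha> i j = 0"
    using m by (intro pair_factor_eq_0 q0 ij) (auto simp: c_def split: if_splits)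
  then have "(\<Prod>(i, j)\<in>index_pairs (length a). pair_factor q a m (c i j) \<alpha> i j) = 0"
    using ij by (intro prod_zero finite_index_pairs bexI[of _ "(i, j)"]) (auto simp: index_pairs_def)
  then show ?thesis by (simp add: grid_term_def)
next
  case True
  \<comment> \<open>If v_0 = 0, then \<open>n = 0\<close> and \<open>N = 0\<close>, so \<alpha>_0 <
    N is impossible and a_0 = 0 contradicts \<open>pos\<close>.\<close>
  have v_pos: "0 < v ! 0"
  proof (rule ccontr)
    assume "\<not> 0 < v ! 0"
    then have "n = 0" using v_less[of 0] by auto
    then have "tl a = []" using len_tl(1) by (metis length_0_conv)
    then have "N = 0" using \<open>\<not> 0 < v ! 0\<close> by (simp add: N_def)
    then show False using \<open>\<not> 0 < v ! 0\<close> assms(2) pos by simp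
  qed
  define M where "M = N + a ! 0 - 1"
  let ?U = "intervals_Un a \<alpha>"
  \<comment> \<open>The grids are chosen so that only x_0 at its last value could reach the exponent
    N + a_0 - 1.\<close>
  have "{\<alpha> i..<\<alpha> i + a ! i} \<subseteq> {..<M}" if i: "i < Suc n" for i
  proof (cases i)
    case 0
    then show ?thesis using assms(2) by (auto simp: M_def)
  next
    case (Suc j)
    then have j: "j < n" using i by simp
    have "\<alpha> i \<in> small_grid j \<union> block j"
      using PiE_mem[OF \<alpha>, of i] i by (simp add: grid_def Suc)
    then have "\<alpha> i + a ! Suc j < N \<or> \<alpha> i + a ! Suc j < N + a ! 0"
      using small_less_block[OF j] a_le_N[OF j] by (auto simp: small_grid_def block_def)
    then show ?thesis using Suc by (auto simp: M_def)
  qed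
  then have U: "?U \<subseteq> {..<M}" by (auto simp: intervals_Un_def len_a)
  have split: "(\<Prod>k<M. linear_fps q k) = (\<Prod>k\<in>{..<M} - ?U. linear_fps q k) * (\<Prod>k\<in>?U. linear_fps q k)"
    by (rule prod.subset_diff[OF U]) simp
  have E_v0: "E (v ! 0) = (\<Prod>k<M. linear_fps q k)" by (simp add: E_def M_def)
  have "E (v ! 0) * complete_sym_fps (scaled_powers q a \<alpha>) =
      (\<Prod>k\<in>{..<M} - ?U. linear_fps q k) * (complete_sym_fps (scaled_powers q a \<alpha>) * (\<Prod>k\<in>?U. linear_fps q k))"
    unfolding E_v0 split by (simp only: mult_ac)
  also have "\<dots> = (\<Prod>k\<in>{..<M} - ?U. linear_fps q k)"
    by (simp only: complete_sym_fps_scaled_powers[OF True] mult_1_right)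
  finally have "(E (v ! 0) * complete_sym_fps (scaled_powers q a \<alpha>)) $ (v ! 0) =
      (\<Prod>k\<in>{..<M} - ?U. linear_fps q k) $ (v ! 0)" by simp
  also have "\<dots> = 0"
  proof -
    have "card ({..<M} - ?U) = M - sum_list a"
      using U by (simp add: card_Diff_subset card_intervals_Un[OF True])
    also have "\<dots> < v ! 0" using pos v_pos by (auto simp: M_def N_def sum_list_a)
    finally show ?thesis
      unfolding linear_fps_def by (intro fps_nth_prod_linear_eq_0) auto
  qed
  finally show ?thesis by (simp add: grid_term_def)
qed

text \<open>Both symbols are read as polynomials in y. If \<open>Suc j < m\<close>, their zeros have
  the exponents [N, N + a_0) and [N - b, N). Otherwise both ranges move up by one, and
  \<open>c\<close> replaces the excess exponent N + a_0 by the missing N - b.\<close>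

lemma pair_factor_top:
  assumes j: "j < n" and \<alpha>: "\<alpha> 0 = N" and a0: "0 < a ! 0"
  defines "y \<equiv> q ^ \<alpha> (Suc j)" and "b \<equiv> a ! Suc j"
  shows "(if Suc j < m then 1 else q ^ b) * q ^ (N * b) * (y ^ (a ! 0) *
      pair_factor q a m (c 0 (Suc j)) \<alpha> 0 (Suc j)) =
    (\<Prod>k<b. - (q ^ Suc k)) * (\<Prod>l\<in>{N - b..<N + a ! 0}. y - q ^ l)"
proof -
  have y: "y \<noteq> 0" and b: "b \<le> N" using q0 a_le_N[OF j] by (simp_all add: y_def b_def)
  have x0: "grid_point q m \<alpha> 0 = q * q ^ N" using m by (simp add: grid_point_def \<alpha>)
  show ?thesis
  proof (cases "Suc j < m")
    case True
    have pf: "pair_factor q a m (c 0 (Suc j)) \<alpha> 0 (Suc j) =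
        qpoch (q ^ N / y) q (a ! 0) * qpoch (q * (y / q ^ N)) q b"
      using True q0 unfolding pair_factor_def x0 by (simp add: c_def grid_point_def y_def b_def)
    have "(q ^ N) ^ b * qpoch (q * (y / q ^ N)) q b =
        (\<Prod>k<b. - (q ^ Suc k)) * (\<Prod>l\<in>{N - b..<N}. y - q ^ l)"
      using q0 by (subst power_mult_qpoch_divide', simp, intro prod_diff_powers_shift b)
    moreover have "y ^ (a ! 0) * qpoch (q ^ N / y) q (a ! 0) = (\<Prod>l\<in>{N..<N + a ! 0}. y - q ^ l)"
      by (simp add: power_mult_qpoch_divide[OF y] prod_shift_lessThan[of "\<lambda>l. y - q ^ l", symmetric] power_add)
    moreover have "(\<Prod>l\<in>{N - b..<N}. y - q ^ l) * (\<Prod>l\<in>{N..<N + a ! 0}. y - q ^ l) =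
        (\<Prod>l\<in>{N - b..<N + a ! 0}. y - q ^ l)"
      by (rule prod.atLeastLessThan_concat) auto
    moreover have "(q ^ N) ^ b * (y ^ (a ! 0) * (P * R)) = ((q ^ N) ^ b * R) * (y ^ (a ! 0) * P)" for P R
      by (simp only: mult_ac)
    ultimately show ?thesis using True unfolding pf
      by (simp only: power_mult if_True mult_1_left) (simp only: mult_ac)
  next
    case False
    obtain d where d: "a ! 0 = Suc d" using a0 by (cases "a ! 0") auto
    have pf: "pair_factor q a m (c 0 (Suc j)) \<alpha> 0 (Suc j) =
        qpoch (q ^ Suc N / y) q d * (1 - q ^ Suc N / y * q ^ d - (q ^ (N - b) - q ^ (N + Suc d)) / y) *
        qpoch (q * (y / q ^ Suc N)) q b"
      using False unfolding pair_factor_def x0 by (simp add: c_def grid_point_def y_def b_def qpoch_shift_def d)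
    have "(q ^ Suc N) ^ b * qpoch (q * (y / q ^ Suc N)) q b =
        (\<Prod>k<b. - (q ^ Suc k)) * (\<Prod>l\<in>{Suc N - b..<Suc N}. y - q ^ l)"
      using q0 b by (subst power_mult_qpoch_divide', simp, intro prod_diff_powers_shift) auto
    moreover have "y ^ d * qpoch (q ^ Suc N / y) q d = (\<Prod>l\<in>{Suc N..<Suc N + d}. y - q ^ l)"
      unfolding power_mult_qpoch_divide[OF y] prod_shift_lessThan[symmetric] by (simp add: power_add mult_ac)
    moreover have "y * (1 - q ^ Suc N / y * q ^ d - (q ^ (N - b) - q ^ (N + Suc d)) / y) = y - q ^ (N - b)"
      using y by (simp add: field_simps power_add)
    moreover have "(\<Prod>l\<in>{N - b..<N + a ! 0}. y - q ^ l) = (y - q ^ (N - b)) *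
        ((\<Prod>l\<in>{Suc N - b..<Suc N}. y - q ^ l) * (\<Prod>l\<in>{Suc N..<Suc N + d}. y - q ^ l))"
      using b d
      by (subst prod.atLeastLessThan_concat) (auto simp: prod.atLeast_Suc_lessThan[of "N - b"] Suc_diff_le)
    moreover have "q ^ b * q ^ (N * b) = (q ^ Suc N) ^ b" by (simp add: power_mult_distrib power_mult)
    moreover have "(q ^ b * q ^ (N * b)) * (y ^ a ! 0 * (P * L * R)) =
        ((q ^ b * q ^ (N * b)) * R) * ((y ^ d * P) * (y * L))" for P L R
      unfolding d power_Suc by (simp only: mult_ac)
    ultimately show ?thesis using False unfolding pf
      by (simp only: if_False) (simp only: mult_ac)
  qed
qed

text \<open>The exponents in \<open>block j\<close> are among the zeros found in
  \<open>pair_factor_top\<close>.\<close>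

lemma big_term_eq_0':
  assumes \<alpha>: "\<alpha> \<in> PiE {..<Suc n} grid" "\<alpha> 0 = N" and a0: "0 < a ! 0"
    and j: "j < n" "\<alpha> (Suc j) \<notin> small_grid j"
  shows "big_term \<alpha> = 0"
proof -
  have "\<alpha> (Suc j) \<in> small_grid j \<union> block j"
    using PiE_mem[OF \<alpha>(1), of "Suc j"] j(1) by (simp add: grid_def)
  then have "\<alpha> (Suc j) \<in> {N - a ! Suc j..<N + a ! 0}" using j(2) by (auto simp: block_def)
  then have "(\<Prod>l\<in>{N - a ! Suc j..<N + a ! 0}. q ^ \<alpha> (Suc j) - q ^ l) = 0"
    by (intro prod_zero) auto
  then have "(if Suc j < m then 1 else q ^ a ! Suc j) * q ^ (N * a ! Suc j) * ((q ^ \<alpha> (Suc j)) ^ (a ! 0) *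
      pair_factor q a m (c 0 (Suc j)) \<alpha> 0 (Suc j)) = 0"
    by (simp only: pair_factor_top[of j \<alpha>, OF j(1) \<alpha>(2) a0] mult_zero_right)
  then have "pair_factor q a m (c 0 (Suc j)) \<alpha> 0 (Suc j) = 0" using q0 by (auto split: if_splits)
  then have "(\<Prod>(i, j)\<in>index_pairs (length a). pair_factor q a m (c i j) \<alpha> i j) = 0"
    using j(1) by (intro prod_zero finite_index_pairs bexI[of _ "(0, Suc j)"]) (auto simp: index_pairs_def len_a)
  then show ?thesis by (simp add: grid_term_def)
qed

text \<open>The grid weight divides out the zeros in \<open>block j\<close>. The b uppermost zeros
  remain, and their product, viewed from the other side, is a product of u - q^k over the interval
  of x_j, where u = q^(N + a_0 - 1). This is the shape of the product produced by h_{v_0}.\<close>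

lemma pair_factor_ratio:
  assumes j: "j < n" and \<alpha>: "\<alpha> 0 = N" "\<alpha> (Suc j) \<in> small_grid j" and a0: "0 < a ! 0"
  defines "y \<equiv> q ^ \<alpha> (Suc j)" and "b \<equiv> a ! Suc j"
  shows "y ^ (a ! 0) * pair_factor q a m (c 0 (Suc j)) \<alpha> 0 (Suc j) / (\<Prod>l\<in>block j. y - q ^ l) =
    (if Suc j < m then q ^ b else 1) / q ^ (N * b) *
      (\<Prod>k\<in>{\<alpha> (Suc j)..<\<alpha> (Suc j) + b}. q ^ (N + a ! 0 - 1) - q ^ k)"
proof -
  define \<kappa> where "\<kappa> = (\<Prod>k<b. - (q ^ Suc k))"
  define P where "P = y ^ (a ! 0) * pair_factor q a m (c 0 (Suc j)) \<alpha> 0 (Suc j)"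
  define B where "B = (\<Prod>l\<in>block j. y - q ^ l)"
  define D where "D = (\<Prod>k\<in>{\<alpha> (Suc j)..<\<alpha> (Suc j) + b}. q ^ (N + a ! 0 - 1) - q ^ k)"
  have b: "b \<le> N" using a_le_N[OF j] by (simp add: b_def)
  have "B \<noteq> 0"
    using small_block_disjoint[OF j] \<alpha>(2) finite_grid by (auto simp: B_def y_def)
  have "q ^ b * D = (\<Prod>k<b. q * (q ^ (N + a ! 0 - 1) - q ^ (\<alpha> (Suc j) + k)))"
    by (simp add: D_def prod_shift_lessThan[symmetric] prod.distrib)
  also have "\<dots> = (\<Prod>k<b. q ^ (N + a ! 0) - y * q ^ Suc k)"
    using a0 by (intro prod.cong) (auto simp: y_def right_diff_distrib power_add mult_ac simp flip: power_Suc)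
  also have "\<dots> = \<kappa> * (\<Prod>l\<in>{N + a ! 0 - b..<N + a ! 0}. y - q ^ l)"
    unfolding \<kappa>_def using b by (intro prod_diff_powers_shift) auto
  finally have D: "q ^ b * D = \<kappa> * (\<Prod>l\<in>{N + a ! 0 - b..<N + a ! 0}. y - q ^ l)" .
  have "B * (\<Prod>l\<in>{N + a ! 0 - b..<N + a ! 0}. y - q ^ l) = (\<Prod>l\<in>{N - b..<N + a ! 0}. y - q ^ l)"
    unfolding B_def block_def b_def[symmetric] by (rule prod.atLeastLessThan_concat) auto
  moreover have "(if Suc j < m then 1 else q ^ b) * q ^ (N * b) * P =
      \<kappa> * (\<Prod>l\<in>{N - b..<N + a ! 0}. y - q ^ l)"
    unfolding P_def y_def b_def \<kappa>_def by (rule pair_factor_top[of j \<alpha>, OF j \<alpha>(1) a0])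
  ultimately have "(if Suc j < m then 1 else q ^ b) * q ^ (N * b) * P = B * (q ^ b * D)"
    unfolding D by (simp only: mult.left_commute[of B \<kappa>])
  then have "P = B * ((if Suc j < m then q ^ b else 1) / q ^ (N * b) * D)"
    using q0 by (simp add: field_simps split: if_splits)
  then show ?thesis using \<open>B \<noteq> 0\<close> unfolding P_def B_def D_def by (simp add: field_simps)
qed

text \<open>The upper argument is N + a_0 - 1, so symmetry of the q-binomial coefficient replaces
  the lower argument a_0 - 1 by N. The prefactors of the two products of differences cancel.\<close>

lemma qbinom_eq:
  assumes "0 < a ! 0"
  shows "qbinom q (int (v ! 0) + int (sum_list a) - 1) (int (a ! 0) - 1) =
    (\<Prod>k<N. q ^ (N + a ! 0 - 1) - q ^ k) / (\<Prod>k<N. q ^ N - q ^ k)"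
proof -
  obtain b where b: "a ! 0 = Suc b" using assms by (cases "a ! 0") auto
  have nz: "qpoch q q k \<noteq> 0" for k
  proof -
    have "1 - q * q ^ i \<noteq> 0" for i using q_powers[of "Suc i"] by simp
    then show ?thesis by (simp add: qpoch_def)
  qed
  have "int (v ! 0) + int (sum_list a) - 1 - (int (a ! 0) - 1) + 1 = int (Suc N)"
    by (simp add: sum_list_a N_def)
  then have "qbinom q (int (v ! 0) + int (sum_list a) - 1) (int (a ! 0) - 1) =
      qpoch (q ^ Suc N) q b / qpoch q q b"
    unfolding qbinom_def by (simp only: power_int_of_nat) (simp add: b)
  also have "\<dots> = qpoch (q ^ Suc b) q N / qpoch q q N"
    using qpoch_add[of q q N b] qpoch_add[of q q b N] nz[of N] nz[of b]
    by (simp add: add.commute field_simps)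
  also have "\<dots> = (\<Prod>k<N. q ^ (N + b) - q ^ k) / (\<Prod>k<N. q ^ (N + 0) - q ^ k)"
    unfolding prod_diff_powers_eq_qpoch using q0 by simp
  finally show ?thesis by (simp add: b)
qed

section \<open>The grid points that survive\<close>

definition extend :: "(nat \<Rightarrow> nat) \<Rightarrow> nat \<Rightarrow> nat"
  where "extend \<alpha> i = (case i of 0 \<Rightarrow> N | Suc j \<Rightarrow> \<alpha> j)"

lemma extend_simps [simp]: "extend \<alpha> 0 = N" "extend \<alpha> (Suc j) = \<alpha> j"
  by (simp_all add: extend_def)

lemma grid_point_extend:
  "grid_point q m (extend \<alpha>) 0 = q * q ^ N"
  "grid_point q m (extend \<alpha>) (Suc j) = grid_point q (m - 1) \<alpha> j"
  using m by (auto simp: grid_point_def)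

lemma pair_factor_extend:
  assumes "i < n" "j < n"
  shows "pair_factor q a m (c (Suc i) (Suc j)) (extend \<alpha>) (Suc i) (Suc j) = pair_factor q (tl a) (m - 1) 0 \<alpha> i j"
  using assms by (simp only: pair_factor_def grid_point_extend tl_nth) (simp add: c_def)

text \<open>The larger grid contributes the nodes in \<open>block j\<close> to the denominator, and
  the exponent in the numerator grows by a_0. Exactly this extra factor occurs in
  \<open>pair_factor_ratio\<close>.\<close>

lemma grid_weight_extend:
  assumes j: "j < n" and \<alpha>: "\<alpha> j \<in> small_grid j"
  shows "grid_weight q (grid (Suc j)) (v ! Suc j + (sum_list a - a ! Suc j)) (\<alpha> j) =
    grid_weight q (small_grid j) (tl v ! j + (sum_list (tl a) - tl a ! j)) (\<alpha> j) *
    ((q ^ \<alpha> j) ^ (a ! 0) / (\<Prod>l\<in>block j. q ^ \<alpha> j - q ^ l))"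
proof -
  have "grid (Suc j) - {\<alpha> j} = (small_grid j - {\<alpha> j}) \<union> block j"
    using small_block_disjoint[OF j] \<alpha> by (auto simp: grid_def)
  then have "(\<Prod>l\<in>grid (Suc j) - {\<alpha> j}. q ^ \<alpha> j - q ^ l) =
      (\<Prod>l\<in>small_grid j - {\<alpha> j}. q ^ \<alpha> j - q ^ l) * (\<Prod>l\<in>block j. q ^ \<alpha> j - q ^ l)"
    using small_block_disjoint[OF j] finite_grid by (simp only:) (subst prod.union_disjoint, auto)
  moreover have "v ! Suc j + (sum_list a - a ! Suc j) =
      (tl v ! j + (sum_list (tl a) - tl a ! j)) + a ! 0"
    using j a_le[OF j] by (simp add: sum_list_a)
  ultimately show ?thesis by (simp add: grid_weight_def power_add)
qed

lemma intervals_extend: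
  assumes a0: "0 < a ! 0" and \<alpha>: "\<alpha> \<in> PiE {..<n} small_grid" and disj: "intervals_disjoint (tl a) \<alpha>"
  shows "intervals_Un (tl a) \<alpha> \<subseteq> {..<N}" "intervals_disjoint a (extend \<alpha>)"
    "intervals_Un a (extend \<alpha>) = {N..<N + a ! 0} \<union> intervals_Un (tl a) \<alpha>"
proof -
  have sub: "{\<alpha> j..<\<alpha> j + a ! Suc j} \<subseteq> {..<N}" if j: "j < n" for j
    using PiE_mem[OF \<alpha>, of j] j small_less_block[OF j] by (auto simp: small_grid_def)
  then show "intervals_Un (tl a) \<alpha> \<subseteq> {..<N}" by (auto simp: intervals_Un_def)
  show "intervals_disjoint a (extend \<alpha>)"
    unfolding intervals_disjoint_def
  proof (intro allI impI)
    fix i j assume ij: "i < j \<and> j < length a"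
    then obtain k where k: "j = Suc k" "k < n" by (cases j) (auto simp: len_a)
    show "{extend \<alpha> i..<extend \<alpha> i + a ! i} \<inter> {extend \<alpha> j..<extend \<alpha> j + a ! j} = {}"
    proof (cases i)
      case 0
      have "{N..<N + a ! 0} \<inter> {\<alpha> k..<\<alpha> k + a ! Suc k} = {}" using sub[OF k(2)] by fastforce
      then show ?thesis by (simp add: 0 k)
    next
      case (Suc l)
      then show ?thesis using disj ij k by (auto simp: intervals_disjoint_def)
    qed
  qed
  have "{..<Suc n} = insert 0 (Suc ` {..<n})" by (rule lessThan_Suc_eq_insert_0)
  then show "intervals_Un a (extend \<alpha>) = {N..<N + a ! 0} \<union> intervals_Un (tl a) \<alpha>"
    by (simp add: intervals_Un_def len_a)
qed

text \<open>Everything depending on x_0 combines to a constant: h_{v_0} yields the u - q^k for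
  exponents outside the other intervals, the pair factors with x_0 yield those for exponents inside,
  and the weight of x_0 supplies the denominator of the q-binomial coefficient.\<close>

lemma big_term_extend:
  assumes a0: "0 < a ! 0" and \<alpha>: "\<alpha> \<in> PiE {..<n} small_grid"
  shows "big_term (extend \<alpha>) =
    q powi (int (\<Sum>i\<in>{1..m - 1}. a ! i) - int (v ! 0)) *
    qbinom q (int (v ! 0) + int (sum_list a) - 1) (int (a ! 0) - 1) * small_term \<alpha>"
proof -
  define \<beta> where "\<beta> = extend \<alpha>"
  define u where "u = q ^ (N + a ! 0 - 1)"
  define F where "F = complete_sym_fps (scaled_powers q a \<beta>)"
  define F' where "F' = complete_sym_fps (scaled_powers q (tl a) \<alpha>)"
  define Q where "Q = (\<Prod>(i, j)\<in>index_pairs n. pair_factor q (tl a) (m - 1) 0 \<alpha> i j)"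
  define X where "X = (\<Prod>i<n. inverse (grid_point q (m - 1) \<alpha> i ^ (tl v ! i)))"
  define W where "W = (\<Prod>i<n. grid_weight q (small_grid i) (tl v ! i + (sum_list (tl a) - tl a ! i)) (\<alpha> i))"
  define H where "H = (\<Prod>r\<leftarrow>decr (tl v). F' $ r)"
  \<comment> \<open>\<open>P j\<close> and \<open>B j\<close> are what the index
    \<open>Suc j\<close> contributes in addition to the term for the shorter sequences: the pair
    factor with x_0 and the extra grid weight.\<close>
  define P where "P j = pair_factor q a m (c 0 (Suc j)) \<beta> 0 (Suc j)" for j
  define B where "B j = (q ^ \<alpha> j) ^ (a ! 0) / (\<Prod>l\<in>block j. q ^ \<alpha> j - q ^ l)" for j
  define R where "R = (\<Prod>k<N. q ^ N - q ^ k)"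
  have small: "\<alpha> j \<in> small_grid j" if "j < n" for j
    using PiE_mem[OF \<alpha>, of j] that by simp
  have small_term: "small_term \<alpha> = X * H * Q * W"
    unfolding grid_term_def X_def W_def Q_def H_def F'_def len_tl by simp
  have big_X: "(\<Prod>i<length a. inverse (grid_point q m \<beta> i ^ (v ! i))) = inverse ((q * q ^ N) ^ (v ! 0)) * X"
    unfolding len_a prod.lessThan_Suc_shift \<beta>_def grid_point_extend X_def by simp
  have big_Q: "(\<Prod>(i, j)\<in>index_pairs (length a). pair_factor q a m (c i j) \<beta> i j) = (\<Prod>j<n. P j) * Q"
  proof -
    have "(\<Prod>(i, j)\<in>index_pairs n. pair_factor q a m (c (Suc i) (Suc j)) \<beta> (Suc i) (Suc j)) = Q"
      unfolding Q_def \<beta>_def by (rule prod.cong) (auto simp: index_pairs_def pair_factor_extend)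
    then show ?thesis unfolding len_a prod_index_pairs_Suc P_def by simp
  qed
  have big_W: "(\<Prod>i<length a. grid_weight q (grid i) (v ! i + (sum_list a - a ! i)) (\<beta> i)) =
      (q ^ N) ^ N / R * (W * (\<Prod>j<n. B j))"
  proof -
    have "{..N} - {N} = {..<N}" by auto
    then have "grid_weight q (grid 0) (v ! 0 + (sum_list a - a ! 0)) N = (q ^ N) ^ N / R"
      by (simp add: grid_weight_def grid_def R_def sum_list_a N_def add.commute)
    moreover have "(\<Prod>j<n. grid_weight q (grid (Suc j)) (v ! Suc j + (sum_list a - a ! Suc j)) (\<alpha> j)) = W * (\<Prod>j<n. B j)"
      unfolding W_def B_def prod.distrib[symmetric]
      by (intro prod.cong refl grid_weight_extend) (auto intro: small)
    ultimately show ?thesis unfolding len_a prod.lessThan_Suc_shift \<beta>_def by simp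
  qed
  \<comment> \<open>If \<open>Q\<close> vanishes, so do both terms. Otherwise the intervals of the
    shorter sequences must be disjoint.\<close>
  show ?thesis
  proof (cases "Q = 0")
    case True
    then have "big_term \<beta> = 0" unfolding grid_term_def big_Q by (simp only: mult_zero_right mult_zero_left)
    moreover have "small_term \<alpha> = 0" unfolding small_term True by simp
    ultimately show ?thesis unfolding \<beta>_def by (simp only: mult_zero_right)
  next
    case False
    have disj: "intervals_disjoint (tl a) \<alpha>"
    proof (rule ccontr)
      assume "\<not> ?thesis"
      then obtain i j where ij: "i < j" "j < n"
        "{\<alpha> i..<\<alpha> i + tl a ! i} \<inter> {\<alpha> j..<\<alpha> j + tl a ! j} \<noteq> {}"
        unfolding intervals_disjoint_def by auto
      have "pair_factor q (tl a) (m - 1) 0 \<alpha> i j = 0"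
        by (rule pair_factor_eq_0[OF q0 ij(1,3)]) simp
      then have "Q = 0" unfolding Q_def
        using ij by (intro prod_zero finite_index_pairs bexI[of _ "(i, j)"]) (auto simp: index_pairs_def)
      with False show False by simp
    qed
    define U where "U = intervals_Un (tl a) \<alpha>"
    define LU where "LU = (\<Prod>k\<in>U. linear_fps q k)"
    define LI where "LI = (\<Prod>k\<in>{N..<N + a ! 0}. linear_fps q k)"
    define LZ where "LZ = (\<Prod>k\<in>{..<N} - U. linear_fps q k)"
    note ext = intervals_extend[OF a0 \<alpha> disj]
    have U: "U \<subseteq> {..<N}" "finite U" using ext(1) by (simp_all add: U_def)
    have F': "F' * LU = 1"
      unfolding F'_def LU_def U_def by (rule complete_sym_fps_scaled_powers[OF disj])
    have F: "F * (LI * LU) = 1"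
    proof -
      have "LI * LU = (\<Prod>k\<in>{N..<N + a ! 0} \<union> U. linear_fps q k)"
        unfolding LI_def LU_def by (rule prod.union_disjoint[symmetric]) (use U in auto)
      then show ?thesis
        using complete_sym_fps_scaled_powers[OF ext(2), of q] by (simp add: F_def \<beta>_def ext(3) U_def)
    qed
    \<comment> \<open>Removing the a_0 variables contributed by x_0 leaves the generating function
      for the shorter sequences. By \<open>v_less\<close> this serves every part of the partition
      except v_0.\<close>
    have "LI * F = LI * F * (F' * LU)" by (simp add: F')
    also have "\<dots> = F' * (F * (LI * LU))" by (simp only: mult_ac)
    finally have LIF: "LI * F = F'" by (simp add: F)
    have H_eq: "(\<Prod>r\<leftarrow>decr (tl v). (E r * F) $ r) = H"
      unfolding H_def
    proof (intro arg_cong[of _ _ prod_list] map_cong refl)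
      fix r assume "r \<in> set (decr (tl v))"
      then obtain j where "j < n" "r = v ! Suc j" by (auto simp: decr_def in_set_conv_nth)
      then have "r \<noteq> v ! 0" using v_less[of j] by simp
      then show "(E r * F) $ r = F' $ r" using LIF by (simp add: E_def LI_def)
    qed
    \<comment> \<open>X contains u, which Y lacks, and Y contains in addition the powers with
      exponents in Z = \<open>{..<N} - U\<close>. As Z has v_0 elements, the coefficient at v_0 is
      the product of the u - z.\<close>
    have top: "(E (v ! 0) * F) $ (v ! 0) = (\<Prod>k\<in>{..<N} - U. u - q ^ k)"
    proof -
      define M where "M = N + a ! 0 - 1"
      have M: "Suc M = N + a ! 0" using a0 by (simp add: M_def)
      have E_v0: "E (v ! 0) = (\<Prod>k<M. linear_fps q k)" by (simp add: E_def M_def)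
      have "E (v ! 0) * linear_fps q M = (\<Prod>k<Suc M. linear_fps q k)"
        by (simp only: E_v0 prod.lessThan_Suc)
      also have "\<dots> = (\<Prod>k<N. linear_fps q k) * LI"
        unfolding LI_def M lessThan_atLeast0 by (rule prod.atLeastLessThan_concat[symmetric]) auto
      also have "(\<Prod>k<N. linear_fps q k) = LZ * LU"
        unfolding LZ_def LU_def by (rule prod.subset_diff[OF U(1)]) simp
      finally have "E (v ! 0) * linear_fps q M = LZ * LU * LI" .
      moreover have "(E (v ! 0) * F) * linear_fps q M = (E (v ! 0) * linear_fps q M) * F"
        by (simp only: mult_ac)
      ultimately have "(E (v ! 0) * F) * linear_fps q M = (LZ * LU * LI) * F" by simp
      also have "\<dots> = LZ * (F * (LI * LU))" by (simp only: mult_ac)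
      also have "\<dots> = LZ" by (simp only: F mult_1_right)
      finally have "(E (v ! 0) * F) $ card ({..<N} - U) = (\<Prod>k\<in>{..<N} - U. q ^ M - q ^ k)"
        unfolding LZ_def linear_fps_def by (intro fps_nth_prod_div_linear) auto
      moreover have "card ({..<N} - U) = v ! 0"
        using U card_intervals_Un[OF disj] by (simp add: card_Diff_subset U_def N_def)
      ultimately show ?thesis by (simp add: u_def M_def)
    qed
    define S where "S = (\<Sum>i\<in>{1..m - 1}. a ! i)"
    have PB: "(\<Prod>j<n. B j * P j) = q ^ S / (q ^ N) ^ sum_list (tl a) * (\<Prod>k\<in>U. u - q ^ k)"
    proof -
      have "B j * P j = (if Suc j < m then q ^ (a ! Suc j) else 1) / q ^ (N * a ! Suc j) *
          (\<Prod>k\<in>{\<alpha> j..<\<alpha> j + a ! Suc j}. u - q ^ k)" if "j < n" for j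
        using pair_factor_ratio[of j \<beta>] that small[OF that] a0 by (simp add: B_def P_def \<beta>_def u_def)
      then have "(\<Prod>j<n. B j * P j) = (\<Prod>j<n. if Suc j < m then q ^ (a ! Suc j) else 1) /
          (\<Prod>j<n. q ^ (N * a ! Suc j)) * (\<Prod>j<n. \<Prod>k\<in>{\<alpha> j..<\<alpha> j + a ! Suc j}. u - q ^ k)"
        by (simp add: prod.distrib prod_dividef)
      also have "(\<Prod>j<n. \<Prod>k\<in>{\<alpha> j..<\<alpha> j + a ! Suc j}. u - q ^ k) = (\<Prod>k\<in>U. u - q ^ k)"
        unfolding U_def prod_intervals_Un[OF disj] by simp
      also have "(\<Prod>j<n. q ^ (N * a ! Suc j)) = (q ^ N) ^ sum_list (tl a)"
        by (simp add: sum_list_sum_nth atLeast0LessThan len_a power_mult power_sum)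
      also have "(\<Prod>j<n. if Suc j < m then q ^ (a ! Suc j) else 1) = q ^ S"
      proof -
        have "(\<Prod>j<n. if Suc j < m then q ^ (a ! Suc j) else 1) = (\<Prod>j<m - 1. q ^ (a ! Suc j))"
          using m by (intro prod.mono_neutral_cong_right) auto
        also have "\<dots> = (\<Prod>i\<in>{1..m - 1}. q ^ (a ! i))"
          by (rule prod.reindex_bij_witness[of _ "\<lambda>i. i - 1" Suc]) auto
        finally show ?thesis by (simp add: S_def power_sum)
      qed
      finally show ?thesis .
    qed
    \<comment> \<open>The union of both ranges no longer depends on \<alpha>, which makes the ratio
      of the two terms constant.\<close>
    have ZU: "(\<Prod>k\<in>{..<N} - U. u - q ^ k) * (\<Prod>k\<in>U. u - q ^ k) = (\<Prod>k<N. u - q ^ k)"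
      by (rule prod.subset_diff[OF U(1), symmetric]) simp
    have "big_term \<beta> = (inverse ((q * q ^ N) ^ (v ! 0)) * X) * ((\<Prod>k\<in>{..<N} - U. u - q ^ k) * H) *
        ((\<Prod>j<n. P j) * Q) * ((q ^ N) ^ N / R * (W * (\<Prod>j<n. B j)))"
      unfolding grid_term_def big_X big_Q big_W F_def[symmetric] list.map prod_list.Cons H_eq top ..
    also have "\<dots> = inverse ((q * q ^ N) ^ (v ! 0)) * ((q ^ N) ^ N / R) *
        ((\<Prod>k\<in>{..<N} - U. u - q ^ k) * (\<Prod>j<n. B j * P j)) * small_term \<alpha>"
      unfolding small_term prod.distrib by (simp only: mult_ac)
    also have "(\<Prod>k\<in>{..<N} - U. u - q ^ k) * (\<Prod>j<n. B j * P j) =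
        q ^ S / (q ^ N) ^ sum_list (tl a) * (\<Prod>k<N. u - q ^ k)"
      unfolding PB ZU[symmetric] by (simp only: mult_ac)
    \<comment> \<open>Since N = |a^(0)| + v_0, all powers of q^N cancel; what remains of x_0^(-v_0)
      is q^(-v_0), because x_0 = q^(N+1).\<close>
    also have "inverse ((q * q ^ N) ^ (v ! 0)) * ((q ^ N) ^ N / R) *
        (q ^ S / (q ^ N) ^ sum_list (tl a) * (\<Prod>k<N. u - q ^ k)) =
        q ^ S / q ^ (v ! 0) * ((\<Prod>k<N. u - q ^ k) / R)"
    proof -
      have "(q ^ N) ^ N = (q ^ N) ^ sum_list (tl a) * (q ^ N) ^ (v ! 0)"
        by (simp only: power_add[symmetric] N_def[symmetric])
      then show ?thesis using q0 by (simp add: power_mult_distrib field_simps)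
    qed
    also have "q ^ S / q ^ (v ! 0) = q powi (int S - int (v ! 0))"
      using q0 by (simp add: power_int_diff)
    also have "(\<Prod>k<N. u - q ^ k) / R = qbinom q (int (v ! 0) + int (sum_list a) - 1) (int (a ! 0) - 1)"
      unfolding qbinom_eq[OF a0] u_def R_def ..
    finally show ?thesis unfolding \<beta>_def S_def .
  qed
qed

lemma recursion:
  "D_coeff q (map int v) (v ! 0 # decr (tl v)) a m =
    q powi (int (\<Sum>i\<in>{1..m - 1}. a ! i) - int (v ! 0)) *
    qbinom q (int (v ! 0) + int (sum_list a) - 1) (int (a ! 0) - 1) *
    D_coeff q (map int (tl v)) (decr (tl v)) (tl a) (m - 1)"
proof (cases "a ! 0 = 0")
  \<comment> \<open>The lower argument of the q-binomial coefficient is -1, so the right-hand side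
    is 0 as well.\<close>
  case True
  then have "(\<Sum>\<alpha>\<in>PiE {..<Suc n} grid. big_term \<alpha>) = 0"
    by (intro sum.neutral ballI big_term_eq_0) auto
  then show ?thesis using True by (simp add: D_coeff_big qbinom_def)
next
  case False
  then have a0: "0 < a ! 0" by simp
  have inj: "inj_on extend (PiE {..<n} small_grid)"
  proof (rule inj_onI, rule ext)
    fix \<alpha> \<beta> j assume "extend \<alpha> = extend \<beta>"
    then have "extend \<alpha> (Suc j) = extend \<beta> (Suc j)" by simp
    then show "\<alpha> j = \<beta> j" by simp
  qed
  have "(\<Sum>\<alpha>\<in>PiE {..<Suc n} grid. big_term \<alpha>) = (\<Sum>\<alpha>\<in>extend ` PiE {..<n} small_grid. big_term \<alpha>)"
  proof (rule sum.mono_neutral_right)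
    show "finite (PiE {..<Suc n} grid)" by (intro finite_PiE) (auto simp: finite_grid)
    show "extend ` PiE {..<n} small_grid \<subseteq> PiE {..<Suc n} grid"
    proof (intro image_subsetI PiE_I)
      fix \<alpha> i assume \<alpha>: "\<alpha> \<in> PiE {..<n} small_grid"
      { assume "i \<in> {..<Suc n}"
        then show "extend \<alpha> i \<in> grid i" using PiE_mem[OF \<alpha>] by (cases i) (auto simp: grid_def) }
      { assume "i \<notin> {..<Suc n}"
        then show "extend \<alpha> i = undefined" using PiE_arb[OF \<alpha>] by (cases i) auto }
    qed
    show "\<forall>\<alpha>\<in>PiE {..<Suc n} grid - extend ` PiE {..<n} small_grid. big_term \<alpha> = 0"
    proof
      fix \<alpha> assume \<alpha>: "\<alpha> \<in> PiE {..<Suc n} grid - extend ` PiE {..<n} small_grid"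
      then have \<alpha>': "\<alpha> \<in> PiE {..<Suc n} grid" by simp
      have "\<alpha> 0 \<le> N" using PiE_mem[OF \<alpha>', of 0] by (simp add: grid_def)
      \<comment> \<open>In the first two cases the term vanishes; the third describes precisely the
        image of \<open>extend\<close>, which has been removed.\<close>
      then consider "\<alpha> 0 < N" | j where "\<alpha> 0 = N" "j < n" "\<alpha> (Suc j) \<notin> small_grid j"
        | "\<alpha> 0 = N" "\<And>j. j < n \<Longrightarrow> \<alpha> (Suc j) \<in> small_grid j"
        by fastforce
      then show "big_term \<alpha> = 0"
      proof cases
        case 1
        then show ?thesis using big_term_eq_0[OF \<alpha>'] by simp
      next
        case 2
        then show ?thesis using big_term_eq_0'[OF \<alpha>' _ a0] by simp
      next
        case 3
        have "(\<lambda>j. \<alpha> (Suc j)) \<in> PiE {..<n} small_grid"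
          using 3 PiE_arb[OF \<alpha>'] by (intro PiE_I) auto
        moreover have "\<alpha> = extend (\<lambda>j. \<alpha> (Suc j))"
          using 3(1) by (auto simp: extend_def split: nat.split)
        ultimately show ?thesis using \<alpha> by blast
      qed
    qed
  qed
  also have "\<dots> = (\<Sum>\<alpha>\<in>PiE {..<n} small_grid. big_term (extend \<alpha>))"
    by (simp add: sum.reindex[OF inj])
  finally show ?thesis
    unfolding D_coeff_big D_coeff_small by (simp add: big_term_extend[OF a0] sum_distrib_left)
qed

end

theorem theorem5p1:
  fixes q :: "'k::field"
    and n m :: nat
    and a v :: "nat list"
  assumes "q \<noteq> 0"
    and "\<And>k::nat. k > 0 \<Longrightarrow> q ^ k \<noteq> 1"
    and "length a = n + 1"
    and "length v = n + 1"
    and "v ! 0 = Max (set v)"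
    and "count_list v (v ! 0) = 1"
    and "v ! 0 > 0 \<or> a ! 0 > 0"
    and "m \<in> {1..n + 1}"
  shows "D_coeff q (map int v) (decr v) a m =
    q powi (int (\<Sum>i\<in>{1..m - 1}. a ! i) - int (v ! 0)) *
    qbinom q (int (v ! 0) + int (sum_list a) - 1) (int (a ! 0) - 1) *
    D_coeff q (map int (tl v)) (decr (tl v)) (tl a) (m - 1)"
proof -
  obtain x w where v: "v = x # w" using assms(4) by (cases v) auto
  have less: "y < x" if "y \<in> set w" for y
  proof -
    have "y \<le> Max (set v)" using that by (intro Max_ge) (auto simp: v)
    moreover have "Max (set v) = x" using assms(5) unfolding v by (metis nth_Cons_0)
    moreover have "x \<notin> set w" using assms(6) by (simp add: v count_list_0_iff)
    ultimately show ?thesis using that by (metis le_neq_implies_less)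
  qed
  have "sort v = sort w @ [x]"
  proof (rule properties_for_sort)
    show "mset (sort w @ [x]) = mset v" by (simp add: v)
    show "sorted (sort w @ [x])" using less by (auto simp: sorted_append intro: less_imp_le)
  qed
  then have decr: "decr v = v ! 0 # decr (tl v)" by (simp add: decr_def v)
  interpret dyson_recursion q n m a v
  proof
    show "v ! Suc j < v ! 0" if "j < n" for j using less assms(4) that by (simp add: v)
  qed (use assms(1-4,7,8) in auto)
  show ?thesis unfolding decr by (rule recursion)
qed

end
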